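(* Let $(M^{2n},J)$ be a compact connected complex manifold and fix $t>0$. Let $\omega$ and $\omega'$ be two Hermitian metrics on $(M,J)$ with constant $t$-deformed scalar curvature that are conformal to each other. Then either $\mu^t(\omega)=\mu^t(\omega')=0$, or else $\mu^t(\omega)$ and $\mu^t(\omega')$ are both nonzero and have the same sign. Moreover, if $\mu^t(\omega)\leq0$, then $\omega'$ is a constant rescaling of $\omega$.
   Context: $n\geq2$ is the complex dimension. A Hermitian metric $g$ on $(M^{2n},J)$ is identified with its $(1,1)$-form $\omega=g(J\cdot,\cdot)$. Two Hermitian metrics are conformal if $\omega'=e^f\omega$ for some smooth real function $f$. $d^*$ is the codifferential of $g$ and $D^g$ the Levi-Civita connection. Chern connection: $g(D^{\mathrm{Ch}}_XY,Z)=g(D^g_XY,Z)-\tfrac12 d\omega(JX,Y,Z)$. Its torsion $T$ is given by $-2g(T(X,Y),Z)=d\omega(JX,Y,Z)+d\omega(X,JY,Z)$, and $|T|^2=\sum_{\alpha,\beta}|T(e_\alpha,e_\beta)|^2$ for a local $g$-orthonormal frame $\{e_\alpha\}_{\alpha=1}^{2n}$. The Lee form is $\theta=\sum_\alpha g(T(\cdot,e_\alpha),e_\alpha)$; equivalently $d\omega^{n-1}=\theta\wedge\omega^{n-1}$. The Chern curvature is $\Theta(X,Y,Z,W)=g(D^{\mathrm{Ch}}_XD^{\mathrm{Ch}}_YZ-D^{\mathrm{Ch}}_YD^{\mathrm{Ch}}_XZ-D^{\mathrm{Ch}}_{[X,Y]}Z,W)$, and the Chern scalar curvature is $\mathrm{scal}^{\mathrm{Ch}}(\omega)=-2\sum_{i,j=1}^n\Theta(e_i,Je_i,e_j,Je_j)$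 for a local unitary frame $\{e_i,Je_i\}_{i=1}^n$. The $t$-deformed scalar curvature is $\mu^t(\omega)=\mathrm{scal}^{\mathrm{Ch}}(\omega)+\frac{t-n}{n-1}\,d^*\theta+\frac{t-2n}{4}\,|T|^2$. *)

theory Defs
  imports "HOL-Analysis.Analysis"
begin

section \<open>Smooth functions\<close>

text \<open>Intended for open \<open>S\<close> only: the derivatives are taken in the full space.\<close>

fun Ck_on :: "nat \<Rightarrow> 'a::real_normed_vector set \<Rightarrow> ('a \<Rightarrow> 'b::real_normed_vector) \<Rightarrow> bool" where
  "Ck_on 0 S f \<longleftrightarrow> continuous_on S f"
| "Ck_on (Suc k) S f \<longleftrightarrow> (\<forall>x\<in>S. f differentiable (at x)) \<and>
     (\<forall>v. Ck_on k S (\<lambda>x. frechet_derivative f (at x) v))"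

definition smooth_on :: "'a::real_normed_vector set \<Rightarrow> ('a \<Rightarrow> 'b::real_normed_vector) \<Rightarrow> bool" where
  "smooth_on S f \<longleftrightarrow> (\<forall>k. Ck_on k S f)"


section \<open>Hermitian geometry on open subsets of complex n-space\<close>

text \<open>
  Points and tangent vectors of an open subset of \<open>\<complex>\<^sup>n\<close> are both elements of \<open>complex ^ 'n\<close>, regarded
  as a real vector space of dimension \<open>2n\<close>. A metric is a function \<open>g\<close> with \<open>g x u v\<close> the value at the
  point \<open>x\<close> on the real tangent vectors \<open>u\<close>, \<open>v\<close>; a vector field is a function from points to
  vectors. All definitions depend only on the germ of \<open>g\<close> at \<open>x\<close>.
\<close>

type_synonym 'n cvec = "complex ^ 'n"
type_synonym 'n metric = "'n cvec \<Rightarrow> 'n cvec \<Rightarrow> 'n cvec \<Rightarrow> real"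
type_synonym 'n vfield = "'n cvec \<Rightarrow> 'n cvec"
type_synonym 'n one_form = "'n cvec \<Rightarrow> 'n cvec \<Rightarrow> real"
type_synonym 'n two_form = "'n cvec \<Rightarrow> 'n cvec \<Rightarrow> 'n cvec \<Rightarrow> real"

definition J :: "'n::finite cvec \<Rightarrow> 'n cvec" where
  "J v = \<i> *s v"

definition fundamental_form :: "'n::finite metric \<Rightarrow> 'n two_form" where
  "fundamental_form g x u v = g x (J u) v"

text \<open>No factor \<open>1/3\<close>: \<open>d(f du \<and> dv) = df \<and> du \<and> dv\<close>, with
  \<open>(du \<and> dv)(a, b) = du a * dv b - du b * dv a\<close>.\<close>

definition ext_deriv2 ::
    "'n::finite two_form \<Rightarrow> 'n cvec \<Rightarrow> 'n cvec \<Rightarrow> 'n cvec \<Rightarrow> 'n cvec \<Rightarrow> real" where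
  "ext_deriv2 w x a b c =
     frechet_derivative (\<lambda>y. w y b c) (at x) a
   - frechet_derivative (\<lambda>y. w y a c) (at x) b
   + frechet_derivative (\<lambda>y. w y a b) (at x) c"

definition lie_bracket :: "'n::finite vfield \<Rightarrow> 'n vfield \<Rightarrow> 'n vfield" where
  "lie_bracket X Y x = frechet_derivative Y (at x) (X x) - frechet_derivative X (at x) (Y x)"

text \<open>
  In coordinates every connection is \<open>D\<^sub>X Y = dY(X) + \<Gamma>(X, Y)\<close> with \<open>\<Gamma>\<close> bilinear at each point. The
  Levi-Civita connection is the unique one that is torsion-free (\<open>\<Gamma>\<close> symmetric) and metric.
\<close>

definition christoffel :: "'n::finite metric \<Rightarrow> 'n cvec \<Rightarrow> 'n cvec \<Rightarrow> 'n cvec \<Rightarrow> 'n cvec" where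
  "christoffel g x = (THE \<Gamma>. bilinear \<Gamma> \<and> (\<forall>u v. \<Gamma> u v = \<Gamma> v u) \<and>
     (\<forall>u v w. frechet_derivative (\<lambda>y. g y v w) (at x) u = g x (\<Gamma> u v) w + g x v (\<Gamma> u w)))"

definition levi_civita :: "'n::finite metric \<Rightarrow> 'n vfield \<Rightarrow> 'n vfield \<Rightarrow> 'n vfield" where
  "levi_civita g X Y x = frechet_derivative Y (at x) (X x) + christoffel g x (X x) (Y x)"

definition chern_connection :: "'n::finite metric \<Rightarrow> 'n vfield \<Rightarrow> 'n vfield \<Rightarrow> 'n vfield" where
  "chern_connection g X Y x = (THE w. \<forall>z.
     g x w z = g x (levi_civita g X Y x) z
               - 1/2 * ext_deriv2 (fundamental_form g) x (J (X x)) (Y x) z)"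

definition chern_torsion :: "'n::finite metric \<Rightarrow> 'n cvec \<Rightarrow> 'n cvec \<Rightarrow> 'n cvec \<Rightarrow> 'n cvec" where
  "chern_torsion g x u v = (THE w. \<forall>z.
     - 2 * g x w z = ext_deriv2 (fundamental_form g) x (J u) v z
                   + ext_deriv2 (fundamental_form g) x u (J v) z)"

text \<open>
  The traces below do not depend on the chosen frame. The index type \<open>'n + 'n\<close> has \<open>2n\<close> elements.
\<close>

definition orthonormal_frame ::
    "('n::finite cvec \<Rightarrow> 'n cvec \<Rightarrow> real) \<Rightarrow> ('n + 'n \<Rightarrow> 'n cvec) \<Rightarrow> bool" where
  "orthonormal_frame h e \<longleftrightarrow> (\<forall>a b. h (e a) (e b) = (if a = b then 1 else 0))"

definition some_orthonormal_frame :: "'n::finite metric \<Rightarrow> 'n cvec \<Rightarrow> 'n + 'n \<Rightarrow> 'n cvec" where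
  "some_orthonormal_frame g x = (SOME e. orthonormal_frame (g x) e)"

text \<open>\<open>{e i, J (e i)}\<close> is orthonormal; \<open>J\<close>-invariance of the metric supplies \<open>h (J (e i)) (J (e j))\<close>.\<close>

definition unitary_frame ::
    "('n::finite cvec \<Rightarrow> 'n cvec \<Rightarrow> real) \<Rightarrow> ('n \<Rightarrow> 'n cvec) \<Rightarrow> bool" where
  "unitary_frame h e \<longleftrightarrow>
     (\<forall>i j. h (e i) (e j) = (if i = j then 1 else 0) \<and> h (e i) (J (e j)) = 0)"

definition some_unitary_frame :: "'n::finite metric \<Rightarrow> 'n cvec \<Rightarrow> 'n \<Rightarrow> 'n cvec" where
  "some_unitary_frame g x = (SOME e. unitary_frame (g x) e)"

definition torsion_norm_sq :: "'n::finite metric \<Rightarrow> 'n cvec \<Rightarrow> real" where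
  "torsion_norm_sq g x = (let e = some_orthonormal_frame g x in
     \<Sum>a\<in>UNIV. \<Sum>b\<in>UNIV. g x (chern_torsion g x (e a) (e b)) (chern_torsion g x (e a) (e b)))"

definition lee_form :: "'n::finite metric \<Rightarrow> 'n one_form" where
  "lee_form g x u = (let e = some_orthonormal_frame g x in
     \<Sum>a\<in>UNIV. g x (chern_torsion g x u (e a)) (e a))"

definition levi_civita_form ::
    "'n::finite metric \<Rightarrow> 'n one_form \<Rightarrow> 'n cvec \<Rightarrow> 'n cvec \<Rightarrow> 'n cvec \<Rightarrow> real" where
  "levi_civita_form g \<theta> x u v =
     frechet_derivative (\<lambda>y. \<theta> y v) (at x) u - \<theta> x (levi_civita g (\<lambda>_. u) (\<lambda>_. v) x)"

text \<open>Sign convention: \<open>d* d\<close> is nonnegative on functions.\<close>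

definition codifferential :: "'n::finite metric \<Rightarrow> 'n one_form \<Rightarrow> 'n cvec \<Rightarrow> real" where
  "codifferential g \<theta> x = (let e = some_orthonormal_frame g x in
     - (\<Sum>a\<in>UNIV. levi_civita_form g \<theta> x (e a) (e a)))"

definition chern_curvature ::
    "'n::finite metric \<Rightarrow> 'n vfield \<Rightarrow> 'n vfield \<Rightarrow> 'n vfield \<Rightarrow> 'n vfield \<Rightarrow> 'n cvec \<Rightarrow> real" where
  "chern_curvature g X Y Z W x =
     g x (chern_connection g X (chern_connection g Y Z) x
          - chern_connection g Y (chern_connection g X Z) x
          - chern_connection g (lie_bracket X Y) Z x) (W x)"

text \<open>The curvature is tensorial, so a frame at \<open>x\<close> may be extended by constant vector fields.\<close>

definition chern_scalar_curvature :: "'n::finite metric \<Rightarrow> 'n cvec \<Rightarrow> real" where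
  "chern_scalar_curvature g x = (let e = some_unitary_frame g x in
     - 2 * (\<Sum>i\<in>UNIV. \<Sum>j\<in>UNIV.
       chern_curvature g (\<lambda>_. e i) (\<lambda>_. J (e i)) (\<lambda>_. e j) (\<lambda>_. J (e j)) x))"

definition local_deformed_scalar_curvature :: "real \<Rightarrow> 'n::finite metric \<Rightarrow> 'n cvec \<Rightarrow> real" where
  "local_deformed_scalar_curvature t g x = (let n = real CARD('n) in
     chern_scalar_curvature g x
     + (t - n) / (n - 1) * codifferential g (lee_form g) x
     + (t - 2 * n) / 4 * torsion_norm_sq g x)"


section \<open>Complex manifolds and Hermitian metrics\<close>

text \<open>
  The points of the manifold are the elements of a Hausdorff type \<open>'m\<close>; second countability is not
  required because it is automatic in the compact case. The complex structure is given by an atlas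
  \<open>A\<close> of charts \<open>(U, \<phi>)\<close>, and \<open>J\<close> is multiplication by \<open>\<i>\<close> in every chart.
\<close>

type_synonym ('m, 'n) chart = "'m set \<times> ('m \<Rightarrow> complex ^ 'n)"

abbreviation chart_dom :: "('m, 'n) chart \<Rightarrow> 'm set" where
  "chart_dom c \<equiv> fst c"

abbreviation chart_map :: "('m, 'n) chart \<Rightarrow> 'm \<Rightarrow> complex ^ 'n" where
  "chart_map c \<equiv> snd c"

definition chart_im :: "('m, 'n) chart \<Rightarrow> (complex ^ 'n) set" where
  "chart_im c = chart_map c ` chart_dom c"

definition chart_inv :: "('m, 'n) chart \<Rightarrow> complex ^ 'n \<Rightarrow> 'm" where
  "chart_inv c = inv_into (chart_dom c) (chart_map c)"

definition holomorphic_map_on ::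
    "(complex ^ 'n::finite) set \<Rightarrow> (complex ^ 'n \<Rightarrow> complex ^ 'n) \<Rightarrow> bool" where
  "holomorphic_map_on S F \<longleftrightarrow>
     (\<forall>z\<in>S. \<exists>L. (F has_derivative L) (at z) \<and> (\<forall>c v. L (c *s v) = c *s L v))"

definition transition :: "('m, 'n) chart \<Rightarrow> ('m, 'n) chart \<Rightarrow> complex ^ 'n \<Rightarrow> complex ^ 'n" where
  "transition c c' = chart_map c' \<circ> chart_inv c"

definition complex_atlas :: "('m::t2_space, 'n::finite) chart set \<Rightarrow> bool" where
  "complex_atlas A \<longleftrightarrow>
     (\<Union>c\<in>A. chart_dom c) = UNIV \<and>
     (\<forall>c\<in>A. open (chart_dom c) \<and> open (chart_im c) \<and>
        homeomorphism (chart_dom c) (chart_im c) (chart_map c) (chart_inv c)) \<and>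
     (\<forall>c\<in>A. \<forall>c'\<in>A. holomorphic_map_on (chart_map c ` (chart_dom c \<inter> chart_dom c')) (transition c c'))"

text \<open>
  A Hermitian metric on the manifold is the family \<open>g\<close> of its coordinate expressions: \<open>g c\<close> is the
  expression in the chart \<open>c\<close>, a function on \<open>chart_im c\<close> whose values elsewhere are irrelevant. The last
  condition says that the expressions in two charts are related by the differential of the
  transition map.
\<close>

type_synonym ('m, 'n) mfd_metric = "('m, 'n) chart \<Rightarrow> 'n metric"

definition hermitian_metric ::
    "('m::t2_space, 'n::finite) chart set \<Rightarrow> ('m, 'n) mfd_metric \<Rightarrow> bool" where
  "hermitian_metric A g \<longleftrightarrow>
     (\<forall>c\<in>A. \<forall>u v. smooth_on (chart_im c) (\<lambda>x. g c x u v)) \<and>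
     (\<forall>c\<in>A. \<forall>x\<in>chart_im c.
        bilinear (g c x) \<and> (\<forall>u v. g c x u v = g c x v u) \<and> (\<forall>u. u \<noteq> 0 \<longrightarrow> g c x u u > 0) \<and>
        (\<forall>u v. g c x (J u) (J v) = g c x u v)) \<and>
     (\<forall>c\<in>A. \<forall>c'\<in>A. \<forall>p\<in>chart_dom c \<inter> chart_dom c'. \<forall>u v.
        let x = chart_map c p; L = frechet_derivative (transition c c') (at x)
        in g c x u v = g c' (chart_map c' p) (L u) (L v))"

definition smooth_function ::
    "('m::t2_space, 'n::finite) chart set \<Rightarrow> ('m \<Rightarrow> real) \<Rightarrow> bool" where
  "smooth_function A f \<longleftrightarrow> (\<forall>c\<in>A. smooth_on (chart_im c) (f \<circ> chart_inv c))"

text \<open>\<open>rescaled A f g g'\<close> states \<open>\<omega>' = f \<omega>\<close> for the fundamental forms of \<open>g\<close> and \<open>g'\<close>.\<close>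

definition rescaled ::
    "('m::t2_space, 'n::finite) chart set \<Rightarrow> ('m \<Rightarrow> real) \<Rightarrow> ('m, 'n) mfd_metric \<Rightarrow> ('m, 'n) mfd_metric \<Rightarrow> bool"
  where
  "rescaled A f g g' \<longleftrightarrow> (\<forall>c\<in>A. \<forall>p\<in>chart_dom c. \<forall>u v.
     fundamental_form (g' c) (chart_map c p) u v = f p * fundamental_form (g c) (chart_map c p) u v)"

definition conformal ::
    "('m::t2_space, 'n::finite) chart set \<Rightarrow> ('m, 'n) mfd_metric \<Rightarrow> ('m, 'n) mfd_metric \<Rightarrow> bool" where
  "conformal A g g' \<longleftrightarrow> (\<exists>f. smooth_function A f \<and> rescaled A (\<lambda>p. exp (f p)) g g')"

text \<open>
  The function \<open>m\<close> on the manifold is the \<open>t\<close>-deformed scalar curvature of \<open>g\<close>. It is the same in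
  all charts, the local expression being built from coordinate-invariant operations.
\<close>

definition is_deformed_scalar_curvature ::
    "('m::t2_space, 'n::finite) chart set \<Rightarrow> real \<Rightarrow> ('m, 'n) mfd_metric \<Rightarrow> ('m \<Rightarrow> real) \<Rightarrow> bool" where
  "is_deformed_scalar_curvature A t g m \<longleftrightarrow> (\<forall>c\<in>A. \<forall>p\<in>chart_dom c.
     m p = local_deformed_scalar_curvature t (g c) (chart_map c p))"

end

theory Submission imports Defs begin

text \<open>
  Write \<open>\<omega>' = e\<^sup>\<phi> \<omega>\<close> and let \<open>n\<close> be the complex dimension. Everything rests on one exact formula,
  \<^item> \<open>e\<^sup>\<phi> \<mu>' = \<mu> - t \<Sum>\<^sub>a (\<partial>\<^sup>2\<phi>(e\<^sub>a, e\<^sub>a) + \<theta>(e\<^sub>a) d\<phi>(e\<^sub>a) + (n - 1)/2 d\<phi>(e\<^sub>a)\<^sup>2)\<close>,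

  valid in every chart at every point, for every \<open>g\<close>-orthonormal frame \<open>e\<close> there
  (\<open>deformed_scalar_curvature_conformal\<close>); \<open>\<partial>\<^sup>2\<phi>\<close> is the matrix of second partial derivatives and \<open>\<theta>\<close>
  the Lee form of \<open>g\<close>. In invariant terms the right-hand side is
  \<open>\<mu> + t (d\<^sup>*d\<phi> - (n - 1)/2 |d\<phi>|\<^sup>2)\<close>. The three coefficients in \<open>\<mu>\<^sup>t\<close> are such that the
  contributions of the Chern scalar curvature, of \<open>d\<^sup>*\<theta>\<close> and of \<open>|T|\<^sup>2\<close> add up to a multiple of \<open>t\<close>, so
  that for \<open>t > 0\<close> the operator on the right is elliptic and has no term of order zero.

  The formula comes from reading the Chern connection in coordinates as \<open>dY(X) + C(X, Y)\<close>, where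
  \<open>2 g(C(u, v), z) = (\<partial>\<^sub>u g)(v, z) - (\<partial>\<^bsub>Ju\<^esub> g)(Jv, z)\<close>. This \<open>C\<close> is complex bilinear, the torsion
  is its antisymmetrization, and a conformal change adds to it the operator \<open>\<partial>\<phi>(u)\<close>, which acts on
  \<open>v\<close> as a complex scalar. Complex scalars commute with each other and with \<open>C(u, \<cdot>)\<close>, so the curvature
  only changes by the antisymmetrized derivative of \<open>\<partial>\<phi>\<close>.

  At a maximum point of \<open>\<phi>\<close> the formula reads \<open>\<mu> \<le> e\<^sup>\<phi> \<mu>'\<close>, at a minimum point \<open>e\<^sup>\<phi> \<mu>' \<le> \<mu>\<close>. Hence \<open>\<mu>\<close> and
  \<open>\<mu>'\<close> have the same sign, and if both are negative then \<open>e\<^bsup>min \<phi>\<^esup> \<ge> e\<^bsup>max \<phi>\<^esup>\<close>, so \<open>\<phi>\<close> is constant. If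
  \<open>\<mu> = \<mu>' = 0\<close> then \<open>\<phi>\<close> satisfies a homogeneous elliptic equation, and Hopf's strong maximum
  principle (\<open>strong_maximum_principle\<close>) makes the set where \<open>\<phi>\<close> attains its maximum open; it is
  closed as well, and the manifold is connected.
\<close>

section \<open>Derivatives of smooth functions\<close>

lemma
  assumes "smooth_on S f"
  shows smooth_on_continuous: "continuous_on S f"
    and smooth_on_differentiable: "\<And>x. x \<in> S \<Longrightarrow> f differentiable (at x)"
    and smooth_on_frechet_derivative: "\<And>v. smooth_on S (\<lambda>x. frechet_derivative f (at x) v)"
proof -
  have k: "Ck_on k S f" for k using assms by (simp add: smooth_on_def)
  show "continuous_on S f" using k[of 0] by simp
  show "f differentiable (at x)" if "x \<in> S" for x using k[of 1] that by simp
  show "smooth_on S (\<lambda>x. frechet_derivative f (at x) v)" for v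
    unfolding smooth_on_def using k[of "Suc _"] by simp
qed

lemma smooth_on_subset:
  assumes "smooth_on S f" "T \<subseteq> S"
  shows "smooth_on T f"
proof -
  have "Ck_on k S f \<Longrightarrow> Ck_on k T f" for k and f :: "'a \<Rightarrow> 'b"
    using assms(2) by (induction k arbitrary: f) (auto intro: continuous_on_subset)
  then show ?thesis using assms(1) by (auto simp: smooth_on_def)
qed

lemma frechet_derivative_eqI: "(f has_derivative f') (at x) \<Longrightarrow> frechet_derivative f (at x) u = f' u"
  using frechet_derivative_at by metis

lemma has_frechet_derivative: "f differentiable (at x) \<Longrightarrow> (f has_derivative frechet_derivative f (at x)) (at x)"
  by (simp add: frechet_derivative_works[symmetric])

lemma frechet_derivative_cong_open:
  assumes "open S" "x \<in> S" "\<And>y. y \<in> S \<Longrightarrow> f y = k y" "k differentiable (at x)"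
  shows "frechet_derivative f (at x) u = frechet_derivative k (at x) u"
  using frechet_derivative_transform_within_open[of k x S f] assms by simp

lemma differentiable_cong_open:
  assumes "open S" "x \<in> S" "\<And>y. y \<in> S \<Longrightarrow> f y = k y" "k differentiable (at x)"
  shows "f differentiable (at x)"
  using has_derivative_transform_within_open[of k _ x UNIV S f] assms
  unfolding differentiable_def by auto

lemma frechet_derivative_add:
  "f differentiable (at x) \<Longrightarrow> k differentiable (at x) \<Longrightarrow>
   frechet_derivative (\<lambda>y. f y + k y) (at x) u = frechet_derivative f (at x) u + frechet_derivative k (at x) u"
  by (rule frechet_derivative_eqI) (intro has_derivative_add has_frechet_derivative)

lemma frechet_derivative_scaleR:
  "f differentiable (at x) \<Longrightarrow>
   frechet_derivative (\<lambda>y. c *\<^sub>R f y) (at x) u = c *\<^sub>R frechet_derivative f (at x) u"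
  by (rule frechet_derivative_eqI) (intro has_derivative_scaleR_right has_frechet_derivative)

text \<open>
Derivatives of a family of linear maps are linear in the parameter. Linearity of the family near
\<open>x\<close>, not only at \<open>x\<close>, is what makes this true.
\<close>

lemma linear_frechet_derivative_param:
  assumes S: "open S" "x \<in> S" and k: "\<And>v. (\<lambda>y. k y v) differentiable (at x)"
    and l: "\<And>y. y \<in> S \<Longrightarrow> linear (k y)"
  shows "linear (\<lambda>v. frechet_derivative (\<lambda>y. k y v) (at x) u)"
proof (rule linearI)
  fix a b r
  have "frechet_derivative (\<lambda>y. k y (a + b)) (at x) u
      = frechet_derivative (\<lambda>y. k y a + k y b) (at x) u"
    by (rule frechet_derivative_cong_open[OF S]) (auto simp: linear_add[OF l] k intro!: derivative_intros)
  then show "frechet_derivative (\<lambda>y. k y (a + b)) (at x) u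
      = frechet_derivative (\<lambda>y. k y a) (at x) u + frechet_derivative (\<lambda>y. k y b) (at x) u"
    by (simp add: frechet_derivative_add k)
  have "frechet_derivative (\<lambda>y. k y (r *\<^sub>R a)) (at x) u
      = frechet_derivative (\<lambda>y. r *\<^sub>R k y a) (at x) u"
    by (rule frechet_derivative_cong_open[OF S]) (auto simp: linear_scale[OF l] k intro!: derivative_intros)
  then show "frechet_derivative (\<lambda>y. k y (r *\<^sub>R a)) (at x) u
      = r *\<^sub>R frechet_derivative (\<lambda>y. k y a) (at x) u"
    by (simp add: frechet_derivative_scaleR k)
qed

definition hess :: "('a::real_normed_vector \<Rightarrow> real) \<Rightarrow> 'a \<Rightarrow> 'a \<Rightarrow> 'a \<Rightarrow> real" where
  "hess f x u v = frechet_derivative (\<lambda>y. frechet_derivative f (at y) v) (at x) u"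

lemma linear_hess:
  assumes S: "open S" "x \<in> S" and f: "smooth_on S f"
  shows "linear (\<lambda>u. hess f x u v)" "linear (\<lambda>v. hess f x u v)"
  unfolding hess_def
  using linear_frechet_derivative[OF smooth_on_differentiable[OF smooth_on_frechet_derivative[OF f] S(2)]]
    linear_frechet_derivative_param[OF S smooth_on_differentiable[OF smooth_on_frechet_derivative[OF f] S(2)]
      linear_frechet_derivative[OF smooth_on_differentiable[OF f]]]
  by auto

section \<open>Maximum principles\<close>

lemma second_derivative_at_max:
  fixes F :: "real \<Rightarrow> real"
  assumes d: "0 < \<delta>" and F: "\<And>s. \<bar>s\<bar> < \<delta> \<Longrightarrow> (F has_real_derivative F' s) (at s)"
    and F'': "(F' has_real_derivative c) (at 0)"
    and max: "\<And>s. \<bar>s\<bar> < \<delta> \<Longrightarrow> F s \<le> F 0"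
  shows "F' 0 = 0" "c \<le> 0"
proof -
  show 0: "F' 0 = 0"
    using DERIV_local_max[OF F[of 0] d] max d by simp
  show "c \<le> 0"
  proof (rule ccontr)
    assume "\<not> c \<le> 0"
    then obtain d' where d': "d' > 0" "\<forall>s>0. s < d' \<longrightarrow> F' 0 < F' s"
      using DERIV_pos_inc_right[OF F''] by auto
    define s where "s = min \<delta> d' / 2"
    have s: "0 < s" "s < \<delta>" "s < d'" using d d'(1) by (auto simp: s_def min_def)
    have "\<exists>z>0. z < s \<and> F s - F 0 = (s - 0) * F' z"
      by (rule MVT2[OF s(1)]) (use F s in auto)
    then obtain z where z: "0 < z" "z < s" "F s - F 0 = s * F' z" by auto
    have "F' z > 0" using d'(2) z s 0 by simp
    then have "F s > F 0" using z(3) s(1) by (smt (verit) mult_pos_pos)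
    then show False using max[of s] s by simp
  qed
qed

text \<open>
The function is restricted to the line through \<open>x\<close> in direction \<open>v\<close>. The second derivative is only
assumed for the directional derivative along \<open>v\<close>, which is all that the definition of smoothness by
iterated directional derivatives provides directly.
\<close>

lemma interior_max_test:
  fixes f :: "'a::real_normed_vector \<Rightarrow> real"
  assumes S: "open S" "x \<in> S" and f: "\<And>y. y \<in> S \<Longrightarrow> (f has_derivative f' y) (at y)"
    and f'': "((\<lambda>y. f' y v) has_derivative f'') (at x)"
    and max: "\<And>y. y \<in> S \<Longrightarrow> f y \<le> f x"
  shows "f' x v = 0" "f'' v \<le> 0"
proof -
  have l: "((\<lambda>s::real. x + s *\<^sub>R v) has_derivative (\<lambda>h. h *\<^sub>R v)) (at s)" for s
    by (auto intro!: derivative_eq_intros)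
  obtain r where r: "r > 0" "ball x r \<subseteq> S" using S openE by blast
  define \<delta> where "\<delta> = r / (norm v + 1)"
  have n: "norm v + 1 > 0" by (smt (verit) norm_ge_zero)
  have \<delta>: "\<delta> > 0" using r n by (simp add: \<delta>_def)
  have inS: "x + s *\<^sub>R v \<in> S" if "\<bar>s\<bar> < \<delta>" for s
  proof -
    have "\<bar>s\<bar> * norm v \<le> \<bar>s\<bar> * (norm v + 1)" by (intro mult_left_mono) auto
    also have "\<dots> < r" using that n by (simp add: \<delta>_def field_simps)
    finally show ?thesis using r by (auto simp: dist_norm)
  qed
  have A: "((\<lambda>s. f (x + s *\<^sub>R v)) has_real_derivative f' (x + s *\<^sub>R v) v) (at s)" if "\<bar>s\<bar> < \<delta>" for s
  proof -
    have "((\<lambda>s. f (x + s *\<^sub>R v)) has_derivative (\<lambda>h. f' (x + s *\<^sub>R v) (h *\<^sub>R v))) (at s)"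
      using diff_chain_at[OF l, of f "f' (x + s *\<^sub>R v)"] f[OF inS[OF that]] by (simp add: o_def)
    moreover have "f' (x + s *\<^sub>R v) (h *\<^sub>R v) = h * f' (x + s *\<^sub>R v) v" for h
      using linear_scale[OF has_derivative_linear[OF f[OF inS[OF that]]]] by simp
    ultimately show ?thesis by (simp add: has_field_derivative_def mult.commute[of _ "f' _ _"])
  qed
  have B: "((\<lambda>s. f' (x + s *\<^sub>R v) v) has_real_derivative f'' v) (at 0)"
  proof -
    have "((\<lambda>s. f' (x + s *\<^sub>R v) v) has_derivative (\<lambda>h. f'' (h *\<^sub>R v))) (at 0)"
      using diff_chain_at[OF l, of "\<lambda>y. f' y v" "f''" 0] f'' by (simp add: o_def)
    moreover have "f'' (h *\<^sub>R v) = h * f'' v" for h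
      using linear_scale[OF has_derivative_linear[OF f'']] by simp
    ultimately show ?thesis by (simp add: has_field_derivative_def mult.commute[of _ "f'' _"])
  qed
  show "f' x v = 0" "f'' v \<le> 0"
    using second_derivative_at_max[OF \<delta> A B] max inS by auto
qed

lemma smooth_max_test:
  fixes f :: "'a::real_normed_vector \<Rightarrow> real"
  assumes "open S" "x \<in> S" "smooth_on S f" "\<And>y. y \<in> S \<Longrightarrow> f y \<le> f x"
  shows "frechet_derivative f (at x) v = 0" "hess f x v v \<le> 0"
  using interior_max_test[of S x f "\<lambda>y. frechet_derivative f (at y)" v "\<lambda>u. hess f x u v"] assms
    smooth_on_differentiable[OF assms(3)]
    smooth_on_differentiable[OF smooth_on_frechet_derivative[OF assms(3)]]
  unfolding hess_def by (auto simp: frechet_derivative_works[symmetric])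

lemma smooth_min_test:
  fixes f :: "'a::real_normed_vector \<Rightarrow> real"
  assumes "open S" "x \<in> S" "smooth_on S f" "\<And>y. y \<in> S \<Longrightarrow> f x \<le> f y"
  shows "frechet_derivative f (at x) v = 0" "0 \<le> hess f x v v"
proof -
  have 1: "((\<lambda>y. - f y) has_derivative (\<lambda>v. - frechet_derivative f (at y) v)) (at y)" if "y \<in> S" for y
    by (intro has_derivative_minus has_frechet_derivative smooth_on_differentiable[OF assms(3) that])
  have 2: "((\<lambda>y. - frechet_derivative f (at y) v) has_derivative (\<lambda>u. - hess f x u v)) (at x)"
    unfolding hess_def
    by (intro has_derivative_minus has_frechet_derivative
        smooth_on_differentiable[OF smooth_on_frechet_derivative[OF assms(3)] assms(2)])
  show "frechet_derivative f (at x) v = 0" "0 \<le> hess f x v v"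
    using interior_max_test[OF assms(1,2) 1 2] assms(4) by simp_all
qed

text \<open>
Hopf's barrier \<open>exp (- \<alpha> |x - y|\<^sup>2)\<close>: for large \<open>\<alpha>\<close> the radial second derivative, of order \<open>\<alpha>\<^sup>2\<close>,
dominates the tangential ones and the gradient, which are of order \<open>\<alpha>\<close>.
\<close>

lemma hopf_barrier_derivatives:
  fixes y :: "'a::real_inner" and \<alpha> :: real
  defines "E \<equiv> \<lambda>x. exp (- \<alpha> * ((x - y) \<bullet> (x - y)))"
  shows "(E has_derivative (\<lambda>v. - 2 * \<alpha> * ((x - y) \<bullet> v) * E x)) (at x)"
    and "((\<lambda>x. - 2 * \<alpha> * ((x - y) \<bullet> v) * E x) has_derivative
           (\<lambda>u. (4 * \<alpha>\<^sup>2 * ((x - y) \<bullet> u) * ((x - y) \<bullet> v) - 2 * \<alpha> * (u \<bullet> v)) * E x)) (at x)"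
proof -
  show E: "(E has_derivative (\<lambda>v. - 2 * \<alpha> * ((x - y) \<bullet> v) * E x)) (at x)" for x
    unfolding E_def
    by (auto intro!: derivative_eq_intros simp: inner_commute algebra_simps fun_eq_iff)
  show "((\<lambda>x. - 2 * \<alpha> * ((x - y) \<bullet> v) * E x) has_derivative
           (\<lambda>u. (4 * \<alpha>\<^sup>2 * ((x - y) \<bullet> u) * ((x - y) \<bullet> v) - 2 * \<alpha> * (u \<bullet> v)) * E x)) (at x)"
    by (rule derivative_eq_intros E refl)+
       (auto simp: fun_eq_iff algebra_simps power2_eq_square)
qed

text \<open>
Ellipticity of \<open>\<Sum>\<^sub>a \<partial>\<^sup>2f(e\<^sub>a, e\<^sub>a)\<close> is expressed by uniform bounds on the frame field \<open>e\<close>, because the frames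
of a metric are chosen point by point. If the claim fails, there are a point \<open>y0\<close> near \<open>z0\<close> with
\<open>f y0 < M\<close> and the largest ball around \<open>y0\<close> on which
\<open>f < M\<close>. It touches the set \<open>f = M\<close> at a point \<open>z\<close>. Adding a small multiple of the barrier centred
inside this ball keeps the value \<open>M\<close> at \<open>z\<close> and makes the function smaller than \<open>M\<close> on the boundary of a small
ball around \<open>z\<close>, so the sum has an interior maximum there. At that point the first derivatives
of \<open>f\<close> and of the barrier cancel, and for large \<open>\<alpha>\<close> the second derivatives contradict the
differential inequality.
\<close>

lemma strong_maximum_principle:
  fixes f :: "'a::euclidean_space \<Rightarrow> real" and e :: "'i::finite \<Rightarrow> 'a \<Rightarrow> 'a"
  assumes S: "open S" and f: "smooth_on S f" and max: "\<And>x. x \<in> S \<Longrightarrow> f x \<le> M"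
    and z0: "z0 \<in> S" "f z0 = M" and lam: "\<kappa> > 0"
    and lower: "\<And>x \<xi>. x \<in> S \<Longrightarrow> \<kappa> * (\<xi> \<bullet> \<xi>) \<le> (\<Sum>a\<in>UNIV. (\<xi> \<bullet> e a x)\<^sup>2)"
    and upper: "\<And>x a. x \<in> S \<Longrightarrow> norm (e a x) \<le> \<Lambda>"
    and sub: "\<And>x. x \<in> S \<Longrightarrow> (\<Sum>a\<in>UNIV. hess f x (e a x) (e a x))
                \<ge> - K * (\<Sum>a\<in>UNIV. \<bar>frechet_derivative f (at x) (e a x)\<bar>)"
  shows "\<exists>r>0. \<forall>x\<in>ball z0 r. x \<in> S \<and> f x = M"
proof (rule ccontr)
  assume neg: "\<not> ?thesis"
  \<comment> \<open>The factor 3 leaves room for the touching ball and for the small ball around \<open>z\<close>.\<close>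
  obtain r where r: "r > 0" "cball z0 (3 * r) \<subseteq> S"
  proof -
    obtain s where "s > 0" "cball z0 s \<subseteq> S" using S z0 open_contains_cball by blast
    then show ?thesis by (intro that[of "s / 3"]) auto
  qed
  have cont: "continuous_on S f" using f by (rule smooth_on_continuous)
  have "ball z0 r \<subseteq> cball z0 (3 * r)" using r by auto
  then obtain y0 where y0: "y0 \<in> ball z0 r" "f y0 \<noteq> M" using neg r by blast
  define Z where "Z = {x \<in> cball z0 (3 * r). f x = M}"
  have "closed Z" unfolding Z_def
    using continuous_closed_preimage_constant[of "cball z0 (3 * r)" f M]
      continuous_on_subset[OF cont r(2)] by simp
  moreover have "z0 \<in> Z" using z0 r by (simp add: Z_def)
  ultimately obtain z where z: "z \<in> Z" "\<And>x. x \<in> Z \<Longrightarrow> dist y0 z \<le> dist y0 x"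
    using distance_attains_inf[of Z y0] by blast
  \<comment> \<open>Halving the radius makes \<open>z\<close> the only point of the closed ball around \<open>y\<close> with value \<open>M\<close>.\<close>
  define R where "R = dist y0 z / 2"
  have Rr: "2 * R < r" using z(2)[OF \<open>z0 \<in> Z\<close>] y0 by (simp add: R_def dist_commute)
  have R: "R > 0" using z y0 by (auto simp: R_def Z_def)
  define y where "y = midpoint y0 z"
  have yz: "dist y z = R" and y0y: "dist y0 y = R"
    by (simp_all add: y_def R_def dist_midpoint)
  have y0z0: "dist z0 y0 < r" using y0 by simp
  have touch: "f x < M" if "dist y x \<le> R" "x \<noteq> z" for x
  proof -
    have "dist y0 x < 2 * R"
    proof -
      have "dist y0 x \<le> 2 * R" using dist_triangle[of y0 x y] y0y that by simp
      moreover have "dist y0 x \<noteq> 2 * R"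
      proof
        assume eq: "dist y0 x = 2 * R"
        then have "dist y x = R" using dist_triangle[of y0 x y] y0y that by simp
        then have "dist y0 x = dist y0 y + dist y x" using eq y0y by simp
        then have "norm ((y0 - y) + (y - x)) = norm (y0 - y) + norm (y - x)" by (simp add: dist_norm)
        then have "norm (y0 - y) *\<^sub>R (y - x) = norm (y - x) *\<^sub>R (y0 - y)"
          by (simp only: norm_triangle_eq)
        then have "y - x = y0 - y"
          using \<open>dist y x = R\<close> y0y R by (simp add: dist_norm)
        then have "x = 2 *\<^sub>R y - y0" by (simp add: algebra_simps scaleR_2)
        then have "x = z" by (simp add: y_def midpoint_def)
        with that show False by simp
      qed
      ultimately show ?thesis by simp
    qed
    then have "x \<notin> Z" using z(2)[of x] by (force simp: R_def)
    moreover have "x \<in> cball z0 (3 * r)"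
      using dist_triangle[of z0 x y0] y0z0 Rr r(1) \<open>dist y0 x < 2 * R\<close> by simp
    ultimately show ?thesis using max[of x] r(2) by (force simp: Z_def)
  qed
  define B where "B = cball z (R / 2)"
  have zM: "f z = M" using z by (simp add: Z_def)
  have BS: "B \<subseteq> S"
  proof
    fix x assume "x \<in> B"
    then have "dist z0 x \<le> 3 * r"
      using dist_triangle[of z0 x y0] dist_triangle[of y0 x z] y0z0 Rr R r(1)
      by (simp add: B_def R_def)
    then show "x \<in> S" using r by auto
  qed
  have rad: "R / 2 \<le> dist y x" "dist y x \<le> 2 * R" if "x \<in> B" for x
    using that dist_triangle[of y z x] dist_triangle[of y x z] yz R
    by (auto simp: B_def dist_commute)
  define N where "N = real CARD('i)"
  have N: "N > 0" by (simp add: N_def)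
  have \<Lambda>0: "\<Lambda> \<ge> 0" using upper[OF z0(1)] norm_ge_zero order_trans by blast
  \<comment> \<open>The right-hand side of the final estimate, plus one, divided by a lower bound for the coefficient of \<open>\<alpha>\<close> on its left.\<close>
  define \<alpha> where "\<alpha> = (N * \<Lambda>\<^sup>2 + 2 * \<bar>K\<bar> * N * R * \<Lambda> + 1) / (\<kappa> * R\<^sup>2 / 2)"
  have den: "\<kappa> * R\<^sup>2 / 2 > 0" using lam R by simp
  have num: "N * \<Lambda>\<^sup>2 + 2 * \<bar>K\<bar> * N * R * \<Lambda> \<ge> 0" using N R \<Lambda>0 by simp
  have \<alpha>: "\<alpha> > 0" using den num by (simp add: \<alpha>_def)
  have \<alpha>eq: "\<alpha> * (\<kappa> * R\<^sup>2 / 2) = N * \<Lambda>\<^sup>2 + 2 * \<bar>K\<bar> * N * R * \<Lambda> + 1"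
    using lam R by (simp add: \<alpha>_def)
  define E where "E = (\<lambda>x. exp (- \<alpha> * ((x - y) \<bullet> (x - y))))"
  define b where "b = (\<lambda>x. E x - exp (- \<alpha> * R\<^sup>2))"
  have E0: "E x > 0" for x by (simp add: E_def)
  have innerd: "(x - y) \<bullet> (x - y) = (dist y x)\<^sup>2" for x
    by (simp add: dist_norm power2_norm_eq_inner norm_minus_commute)
  have b_neg: "b x < 0" if "dist y x > R" for x
    using that R \<alpha> by (simp add: b_def E_def innerd power_strict_mono)
  have bz: "b z = 0" by (simp add: b_def E_def innerd yz)
  have b1: "b x \<le> 1" for x
    unfolding b_def E_def innerd using \<alpha> by (smt (verit) exp_gt_zero exp_le_one_iff mult_nonneg_nonneg zero_le_power2 mult_minus_left)
  have contb: "continuous_on X b" for X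
    unfolding b_def E_def by (intro continuous_intros)
  define C where "C = sphere z (R / 2) \<inter> cball y R"
  have CB: "C \<subseteq> B" by (auto simp: C_def B_def)
  have "compact C" by (auto simp: C_def intro: compact_Int_closed)
  \<comment> \<open>On the part \<open>C\<close> of the boundary sphere that lies in the touching ball, \<open>f\<close> stays below \<open>M\<close> by a definite amount; elsewhere on the sphere the barrier is negative.\<close>
  obtain \<epsilon> where \<epsilon>: "\<epsilon> > 0" "\<And>x. x \<in> C \<Longrightarrow> f x + \<epsilon> * b x < M"
  proof (cases "C = {}")
    case True then show ?thesis using that[of 1] by simp
  next
    case False
    then obtain w where w: "w \<in> C" "\<And>x. x \<in> C \<Longrightarrow> f x \<le> f w"
      using continuous_attains_sup[OF \<open>compact C\<close> False]
        continuous_on_subset[OF cont] CB BS by (metis (full_types) subset_trans)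
    have "f w < M" using w(1) R by (intro touch) (auto simp: C_def)
    moreover define d where "d = (M - f w) / 2"
    ultimately have d: "d > 0" "f w + d < M" by (auto simp: field_simps)
    show ?thesis
    proof (rule that[OF d(1)])
      fix x assume x: "x \<in> C"
      have "d * b x \<le> d * 1"
        using d b1 by (intro mult_left_mono) auto
      then show "f x + d * b x < M" using w(2)[OF x] d(2) by simp
    qed
  qed
  define F where "F = (\<lambda>x. f x + \<epsilon> * b x)"
  have "continuous_on B F" unfolding F_def
    by (intro continuous_intros contb continuous_on_subset[OF cont BS])
  moreover have "compact B" "B \<noteq> {}" using R by (auto simp: B_def)
  ultimately have "\<exists>q\<in>B. \<forall>x\<in>B. F x \<le> F q" by (intro continuous_attains_sup)
  then obtain q where q: "q \<in> B" "\<And>x. x \<in> B \<Longrightarrow> F x \<le> F q" by blast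
  have "F q \<ge> M" using q(2)[of z] R bz zM by (simp add: F_def B_def)
  have "q \<in> ball z (R / 2)"
  proof (rule ccontr)
    assume "q \<notin> ball z (R / 2)"
    then have s: "q \<in> sphere z (R / 2)" using q(1) by (auto simp: B_def)
    show False
    proof (cases "dist y q \<le> R")
      case True
      then have "q \<in> C" using s by (simp add: C_def)
      then show False using \<epsilon>(2) \<open>F q \<ge> M\<close> by (force simp: F_def)
    next
      case False
      then have "\<epsilon> * b q < 0" using b_neg[of q] \<epsilon>(1) by (simp add: mult_pos_neg)
      then show False using max[of q] q(1) BS \<open>F q \<ge> M\<close> by (force simp: F_def)
    qed
  qed
  have qS: "q \<in> S" using q(1) BS by auto
  have dE: "(E has_derivative (\<lambda>v. - 2 * \<alpha> * ((x - y) \<bullet> v) * E x)) (at x)"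
    "((\<lambda>x. - 2 * \<alpha> * ((x - y) \<bullet> v) * E x) has_derivative
           (\<lambda>u. (4 * \<alpha>\<^sup>2 * ((x - y) \<bullet> u) * ((x - y) \<bullet> v) - 2 * \<alpha> * (u \<bullet> v)) * E x)) (at x)" for x v
    unfolding E_def by (rule hopf_barrier_derivatives)+
  define F' where "F' = (\<lambda>x v. frechet_derivative f (at x) v + \<epsilon> * (- 2 * \<alpha> * ((x - y) \<bullet> v) * E x))"
  have dF: "(F has_derivative F' x) (at x)" if "x \<in> ball z (R / 2)" for x
  proof -
    have "x \<in> S" using that BS by (auto simp: B_def)
    then have "(f has_derivative frechet_derivative f (at x)) (at x)"
      using smooth_on_differentiable[OF f] by (simp add: frechet_derivative_works[symmetric])
    from has_derivative_add[OF this has_derivative_mult_right[OF has_derivative_diff[OF dE(1) has_derivative_const], of \<epsilon> "exp (- \<alpha> * R\<^sup>2)"]]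
    show ?thesis unfolding F_def F'_def b_def by simp
  qed
  have ddF: "((\<lambda>x. F' x v) has_derivative (\<lambda>u. hess f q u v +
      \<epsilon> * ((4 * \<alpha>\<^sup>2 * ((q - y) \<bullet> u) * ((q - y) \<bullet> v) - 2 * \<alpha> * (u \<bullet> v)) * E q))) (at q)" for v
  proof -
    have "((\<lambda>x. frechet_derivative f (at x) v) has_derivative (\<lambda>u. hess f q u v)) (at q)"
      using smooth_on_differentiable[OF smooth_on_frechet_derivative[OF f] qS, of v]
      unfolding hess_def by (simp add: frechet_derivative_works[symmetric])
    from has_derivative_add[OF this has_derivative_mult_right[OF dE(2), of \<epsilon>]]
    show ?thesis unfolding F'_def by simp
  qed
  have F1: "F' q v = 0" and F2: "hess f q v v +
      \<epsilon> * ((4 * \<alpha>\<^sup>2 * ((q - y) \<bullet> v) * ((q - y) \<bullet> v) - 2 * \<alpha> * (v \<bullet> v)) * E q) \<le> 0" for v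
    using interior_max_test[of "ball z (R / 2)" q F F', OF _ _ dF ddF] \<open>q \<in> ball z (R / 2)\<close> q(2)
    by (auto simp: B_def)
  define \<xi> where "\<xi> = q - y"
  define c where "c = 2 * \<alpha> * \<epsilon> * E q"
  have c: "c > 0" using \<alpha> \<epsilon>(1) E0 by (simp add: c_def)
  have df: "frechet_derivative f (at q) v = c * (\<xi> \<bullet> v)" for v
    using F1[of v] by (simp add: F'_def \<xi>_def c_def algebra_simps)
  have hf: "hess f q v v \<le> c * (v \<bullet> v) - c * (2 * \<alpha> * (\<xi> \<bullet> v)\<^sup>2)" for v
    using F2[of v] by (simp add: \<xi>_def c_def algebra_simps power2_eq_square)
  have n\<xi>: "R / 2 \<le> norm \<xi>" "norm \<xi> \<le> 2 * R"
    using rad[OF q(1)] by (auto simp: \<xi>_def dist_norm norm_minus_commute)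
  let ?e = "\<lambda>a. e a q"
  have e2: "?e a \<bullet> ?e a \<le> \<Lambda>\<^sup>2" for a
    using upper[OF qS, of a] by (metis norm_ge_zero power2_norm_eq_inner power_mono)
  have "- \<bar>K\<bar> * (\<Sum>a\<in>UNIV. \<bar>c * (\<xi> \<bullet> ?e a)\<bar>) \<le> - K * (\<Sum>a\<in>UNIV. \<bar>c * (\<xi> \<bullet> ?e a)\<bar>)"
    by (intro mult_right_mono sum_nonneg) auto
  also have "\<dots> \<le> (\<Sum>a\<in>UNIV. hess f q (?e a) (?e a))"
    using sub[OF qS] by (simp add: df)
  also have "\<dots> \<le> (\<Sum>a\<in>UNIV. c * (?e a \<bullet> ?e a) - c * (2 * \<alpha> * (\<xi> \<bullet> ?e a)\<^sup>2))"
    by (intro sum_mono hf)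
  also have "\<dots> = c * ((\<Sum>a\<in>UNIV. ?e a \<bullet> ?e a) - 2 * \<alpha> * (\<Sum>a\<in>UNIV. (\<xi> \<bullet> ?e a)\<^sup>2))"
    by (simp add: sum_subtractf sum_distrib_left right_diff_distrib)
  finally have "c * (2 * \<alpha> * (\<Sum>a\<in>UNIV. (\<xi> \<bullet> ?e a)\<^sup>2)) \<le>
     c * ((\<Sum>a\<in>UNIV. ?e a \<bullet> ?e a) + \<bar>K\<bar> * (\<Sum>a\<in>UNIV. \<bar>\<xi> \<bullet> ?e a\<bar>))"
    using c by (simp add: abs_mult algebra_simps flip: sum_distrib_left)
  then have main: "2 * \<alpha> * (\<Sum>a\<in>UNIV. (\<xi> \<bullet> ?e a)\<^sup>2) \<le>
     (\<Sum>a\<in>UNIV. ?e a \<bullet> ?e a) + \<bar>K\<bar> * (\<Sum>a\<in>UNIV. \<bar>\<xi> \<bullet> ?e a\<bar>)"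
    using c by simp
  have "(\<Sum>a\<in>UNIV. ?e a \<bullet> ?e a) \<le> N * \<Lambda>\<^sup>2"
    using sum_mono[of UNIV "\<lambda>a. ?e a \<bullet> ?e a" "\<lambda>_. \<Lambda>\<^sup>2"] e2 by (simp add: N_def)
  moreover have "(\<Sum>a\<in>UNIV. \<bar>\<xi> \<bullet> ?e a\<bar>) \<le> (\<Sum>a\<in>(UNIV::'i set). 2 * R * \<Lambda>)"
  proof (rule sum_mono)
    fix a
    have "\<bar>\<xi> \<bullet> ?e a\<bar> \<le> norm \<xi> * norm (?e a)" by (rule Cauchy_Schwarz_ineq2)
    also have "\<dots> \<le> 2 * R * \<Lambda>" using n\<xi> upper[OF qS] R by (intro mult_mono) auto
    finally show "\<bar>\<xi> \<bullet> ?e a\<bar> \<le> 2 * R * \<Lambda>" .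
  qed
  then have "\<bar>K\<bar> * (\<Sum>a\<in>UNIV. \<bar>\<xi> \<bullet> ?e a\<bar>) \<le> \<bar>K\<bar> * (N * (2 * R * \<Lambda>))"
    by (intro mult_left_mono) (auto simp: N_def)
  moreover have "\<alpha> * (\<kappa> * R\<^sup>2 / 2) \<le> 2 * \<alpha> * (\<Sum>a\<in>UNIV. (\<xi> \<bullet> ?e a)\<^sup>2)"
  proof -
    have "(R / 2)\<^sup>2 \<le> \<xi> \<bullet> \<xi>"
      using n\<xi>(1) R by (metis less_eq_real_def half_gt_zero power2_norm_eq_inner power_mono)
    then have "\<kappa> * (R / 2)\<^sup>2 \<le> \<kappa> * (\<xi> \<bullet> \<xi>)"
      using lam by (intro mult_left_mono) auto
    also have "\<dots> \<le> (\<Sum>a\<in>UNIV. (\<xi> \<bullet> ?e a)\<^sup>2)" by (rule lower[OF qS])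
    finally have "2 * \<alpha> * (\<kappa> * (R / 2)\<^sup>2) \<le> 2 * \<alpha> * (\<Sum>a\<in>UNIV. (\<xi> \<bullet> ?e a)\<^sup>2)"
      using \<alpha> by (intro mult_left_mono) auto
    moreover have "\<alpha> * (\<kappa> * R\<^sup>2 / 2) = 2 * \<alpha> * (\<kappa> * (R / 2)\<^sup>2)" by (simp add: power2_eq_square)
    ultimately show ?thesis by (simp only:)
  qed
  ultimately show False using main \<alpha>eq by (simp add: algebra_simps)
qed

section \<open>Hermitian forms and their frames\<close>

lemma J_J [simp]: "J (J v) = - v"
  by (simp add: J_def vec_eq_iff)

lemma linear_J: "linear J"
  by (rule linearI) (simp_all add: J_def vec_eq_iff algebra_simps)

lemma J_simps [simp]:
  "J (u + v) = J u + J v" "J (u - v) = J u - J v" "J (c *\<^sub>R u) = c *\<^sub>R J u" "J (- u) = - J u" "J 0 = 0"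
  using linear_add[OF linear_J] linear_diff[OF linear_J] linear_scale[OF linear_J]
    linear_neg[OF linear_J] linear_0[OF linear_J] by auto

locale hermitian_form =
  fixes h :: "'n::finite cvec \<Rightarrow> 'n cvec \<Rightarrow> real"
  assumes bilinear: "bilinear h"
    and sym: "h u v = h v u"
    and pos: "u \<noteq> 0 \<Longrightarrow> h u u > 0"
    and J_J_eq: "h (J u) (J v) = h u v"
begin

lemma lin_left: "linear (\<lambda>u. h u v)" and lin_right: "linear (h v)"
  using bilinear by (auto simp: bilinear_def)

lemmas h_simps =
  linear_add[OF lin_left] linear_diff[OF lin_left] linear_scale[OF lin_left]
  linear_neg[OF lin_left] linear_0[OF lin_left] linear_sum[OF lin_left]
  linear_add[OF lin_right] linear_diff[OF lin_right] linear_scale[OF lin_right]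
  linear_neg[OF lin_right] linear_0[OF lin_right] linear_sum[OF lin_right]

lemma J_skew: "h (J u) v = - h u (J v)"
  using J_J_eq[of u "J v"] by (simp add: h_simps)

lemma J_orthogonal [simp]: "h u (J u) = 0" "h (J u) u = 0"
  using J_skew[of u u] sym[of u "J u"] by auto

lemma eqI: "(\<And>z. h u z = h v z) \<Longrightarrow> u = v"
  using pos[of "u - v"] by (force simp: h_simps)

text \<open>
An orthonormal family is linearly independent, and the index type has as many elements as the real
dimension of \<open>\<complex>\<^sup>n\<close>, so it is a basis.
\<close>

lemma orthonormal_expansion:
  assumes e: "orthonormal_frame h e"
  shows "(\<Sum>a\<in>UNIV. h v (e a) *\<^sub>R e a) = v"
proof -
  have h: "h (e a) (e b) = (if a = b then 1 else 0)" for a b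
    using e by (simp add: orthonormal_frame_def)
  have inj: "inj e"
    by (rule injI) (metis h zero_neq_one)
  have coeff: "h (\<Sum>a\<in>UNIV. c a *\<^sub>R e a) (e b) = c b" for c b
    by (simp add: h_simps h if_distrib[where f="\<lambda>x. _ * x"] cong: if_cong)
  have "independent (range e)"
  proof (rule independent_if_scalars_zero)
    show "finite (range e)" by simp
    fix f x assume z: "(\<Sum>x\<in>range e. f x *\<^sub>R x) = 0" and x: "x \<in> range e"
    have "(\<Sum>a\<in>UNIV. f (e a) *\<^sub>R e a) = 0"
      using z by (simp add: sum.reindex inj)
    then show "f x = 0" using coeff[of "\<lambda>a. f (e a)"] x by (auto simp: h_simps)
  qed
  moreover have "card (range e) = DIM('n cvec)"
    by (simp add: card_image inj)
  ultimately have "v \<in> span (range e)"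
    by (metis UNIV_I card_eq_dim dim_UNIV finite_imageI finite subset_UNIV subset_eq)
  then obtain f where f: "v = (\<Sum>x\<in>range e. f x *\<^sub>R x)"
    by (auto simp: span_finite)
  also have "\<dots> = (\<Sum>a\<in>UNIV. f (e a) *\<^sub>R e a)"
    by (simp add: sum.reindex inj)
  finally have v: "v = (\<Sum>a\<in>UNIV. f (e a) *\<^sub>R e a)" .
  have "h v (e b) = f (e b)" for b
    by (subst v) (rule coeff)
  then show ?thesis using v by simp
qed

lemma parseval:
  assumes e: "orthonormal_frame h e"
  shows "(\<Sum>a\<in>UNIV. h u (e a) * h v (e a)) = h u v"
proof -
  have "h u v = h u (\<Sum>a\<in>UNIV. h v (e a) *\<^sub>R e a)"
    by (simp only: orthonormal_expansion[OF e])
  also have "\<dots> = (\<Sum>a\<in>UNIV. h u (e a) * h v (e a))"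
    by (simp add: h_simps mult.commute)
  finally show ?thesis by simp
qed

lemma linear_expansion:
  fixes l :: "_ \<Rightarrow> 'b::real_vector"
  assumes e: "orthonormal_frame h e" and l: "linear l"
  shows "(\<Sum>a\<in>UNIV. h v (e a) *\<^sub>R l (e a)) = l v"
proof -
  have "l v = l (\<Sum>a\<in>UNIV. h v (e a) *\<^sub>R e a)"
    by (simp only: orthonormal_expansion[OF e])
  also have "\<dots> = (\<Sum>a\<in>UNIV. h v (e a) *\<^sub>R l (e a))"
    by (simp only: linear_sum[OF l] linear_scale[OF l])
  finally show ?thesis by simp
qed

text \<open>
The frames that occur in the definitions of Lee form, codifferential, torsion norm and scalar
curvature are arbitrary choices, made separately for \<open>g\<close> and \<open>g'\<close>. This lemma allows one frame to be
used throughout.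
\<close>

lemma trace_frame_independent:
  fixes B :: "_ \<Rightarrow> _ \<Rightarrow> real"
  assumes B: "bilinear B" and e: "orthonormal_frame h e" and e': "orthonormal_frame h e'"
  shows "(\<Sum>a\<in>UNIV. B (e' a) (e' a)) = (\<Sum>a\<in>UNIV. B (e a) (e a))"
proof -
  have l: "linear (B u)" "linear (\<lambda>u. B u v)" for u v
    using B by (auto simp: bilinear_def)
  have "(\<Sum>a\<in>UNIV. B (e' a) (e' a)) = (\<Sum>a\<in>UNIV. \<Sum>b\<in>UNIV. h (e' a) (e b) * B (e b) (e' a))"
    using linear_expansion[OF e l(2)] by simp
  also have "\<dots> = (\<Sum>b\<in>UNIV. \<Sum>a\<in>UNIV. h (e b) (e' a) * B (e b) (e' a))"
    by (subst sum.swap) (simp add: sym)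
  also have "\<dots> = (\<Sum>b\<in>UNIV. B (e b) (e b))"
    using linear_expansion[OF e' l(1)] by simp
  finally show ?thesis .
qed

text \<open>
The trace of an endomorphism does not involve the metric. Written in the standard basis it is visibly
differentiable in the base point and unaffected by a conformal change.
\<close>

lemma trace_eq_sum_Basis:
  assumes e: "orthonormal_frame h e" and A: "linear A"
  shows "(\<Sum>a\<in>UNIV. h (A (e a)) (e a)) = (\<Sum>b\<in>Basis. A b \<bullet> b)"
proof -
  have "(\<Sum>b\<in>Basis. A b \<bullet> b) = (\<Sum>b\<in>Basis. \<Sum>a\<in>UNIV. h b (e a) * (A (e a) \<bullet> b))"
  proof (rule sum.cong)
    fix b :: "'n cvec"
    have "linear (\<lambda>v. A v \<bullet> b)"
      using A by (auto intro!: linearI simp: linear_add linear_scale inner_add_left)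
    from linear_expansion[OF e this, of b]
    show "A b \<bullet> b = (\<Sum>a\<in>UNIV. h b (e a) * (A (e a) \<bullet> b))" by simp
  qed simp
  also have "\<dots> = (\<Sum>a\<in>UNIV. \<Sum>b\<in>Basis. (A (e a) \<bullet> b) * h b (e a))"
    by (subst sum.swap) (simp add: mult.commute)
  also have "\<dots> = (\<Sum>a\<in>UNIV. h (\<Sum>b\<in>Basis. (A (e a) \<bullet> b) *\<^sub>R b) (e a))"
    by (simp only: h_simps real_scaleR_def)
  finally show ?thesis by (simp only: euclidean_representation)
qed

text \<open>
The vectors \<open>e i\<close> and \<open>J (e i)\<close> span a space of real dimension at most \<open>2 (card I) < 2n\<close>; a vector
outside it, minus its projection, is the new direction.
\<close>

lemma unitary_extension:
  assumes "finite I" "card I < CARD('n)"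
    and e: "\<forall>i\<in>I. \<forall>j\<in>I. h (e i) (e j) = (if i = j then 1 else 0) \<and> h (e i) (J (e j)) = 0"
  obtains w where "h w w = 1" "\<And>i. i \<in> I \<Longrightarrow> h w (e i) = 0 \<and> h w (J (e i)) = 0"
proof -
  let ?S = "e ` I \<union> (J \<circ> e) ` I"
  have fS: "finite ?S" using assms(1) by auto
  have "card ?S \<le> card (e ` I) + card ((J \<circ> e) ` I)" by (rule card_Un_le)
  also have "\<dots> \<le> card I + card I" using assms(1) by (meson add_mono card_image_le)
  finally have "card ?S < DIM('n cvec)" using assms(2) by simp
  then have "dim (span ?S) < DIM('n cvec)"
    using dim_le_card'[OF fS] by simp
  then have "span ?S \<noteq> UNIV" by (metis dim_UNIV less_irrefl)
  then obtain v where v: "v \<notin> span ?S" by auto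
  define p where "p = (\<Sum>i\<in>I. h v (e i) *\<^sub>R e i + h v (J (e i)) *\<^sub>R J (e i))"
  have "p \<in> span ?S"
    unfolding p_def by (intro span_sum span_add span_scale span_base) auto
  then have ne: "v - p \<noteq> 0" using v by auto
  have o: "h (v - p) (e i) = 0 \<and> h (v - p) (J (e i)) = 0" if "i \<in> I" for i
  proof -
    have "h p (e i) = (\<Sum>j\<in>I. if j = i then h v (e i) else 0)"
      unfolding p_def h_simps using e that by (intro sum.cong) (auto simp: h_simps J_skew)
    moreover have "h p (J (e i)) = (\<Sum>j\<in>I. if j = i then h v (J (e i)) else 0)"
      unfolding p_def h_simps using e that by (intro sum.cong) (auto simp: h_simps J_J_eq)
    ultimately show ?thesis using that assms(1) by (simp add: h_simps)
  qed
  define u where "u = v - p"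
  have u: "h u u > 0" and ou: "\<And>i. i \<in> I \<Longrightarrow> h u (e i) = 0 \<and> h u (J (e i)) = 0"
    using pos[OF ne] o by (auto simp: u_def)
  define c where "c = 1 / sqrt (h u u)"
  have "c * (c * h u u) = 1" using u by (simp add: c_def)
  then show ?thesis
    using ou by (intro that[of "c *\<^sub>R u"]) (auto simp: h_simps)
qed

lemma unitary_frame_exists: "\<exists>e. unitary_frame h e"
proof -
  have "\<exists>e. \<forall>i\<in>I. \<forall>j\<in>I. h (e i) (e j) = (if i = j then 1 else 0) \<and> h (e i) (J (e j)) = 0"
    if "finite I" for I :: "'n set"
    using that
  proof (induction I)
    case (insert k I)
    then obtain e where e: "\<forall>i\<in>I. \<forall>j\<in>I. h (e i) (e j) = (if i = j then 1 else 0) \<and> h (e i) (J (e j)) = 0"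
      by blast
    have "card I < CARD('n)"
      using insert.hyps by (intro psubset_card_mono) auto
    with unitary_extension[OF insert.hyps(1) _ e] obtain w
      where w: "h w w = 1" "\<And>i. i \<in> I \<Longrightarrow> h w (e i) = 0 \<and> h w (J (e i)) = 0" by blast
    have w': "h (e i) w = 0 \<and> h (e i) (J w) = 0" if "i \<in> I" for i
      using w(2)[OF that] sym[of w "e i"] J_skew[of w "e i"] sym[of "J w" "e i"] by simp
    show ?case
      using e w w' insert.hyps by (intro exI[of _ "e(k := w)"]) auto
  qed simp
  from this[of UNIV] show ?thesis by (simp add: unitary_frame_def)
qed

lemma orthonormal_of_unitary:
  assumes "unitary_frame h e"
  shows "orthonormal_frame h (case_sum e (J \<circ> e))"
  using assms unfolding orthonormal_frame_def unitary_frame_def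
  by (auto simp: J_J_eq J_skew h_simps split: sum.split)

lemma orthonormal_frame_exists: "\<exists>e. orthonormal_frame h e"
  using unitary_frame_exists orthonormal_of_unitary by blast

lemma orthonormal_J:
  "orthonormal_frame h e \<Longrightarrow> orthonormal_frame h (\<lambda>a. J (e a))"
  by (simp add: orthonormal_frame_def J_J_eq)

lemma riesz:
  assumes k: "linear k"
  shows "\<exists>w. \<forall>z. h w z = k z"
proof -
  obtain e where e: "orthonormal_frame h e" using orthonormal_frame_exists by blast
  have "h (\<Sum>a\<in>UNIV. k (e a) *\<^sub>R e a) z = k z" for z
    using linear_expansion[OF e k, of z] by (simp add: h_simps sym mult.commute)
  then show ?thesis by blast
qed

end

context hermitian_form
begin

lemma double_trace_frame_independent:
  fixes B :: "_ \<Rightarrow> _ \<Rightarrow> _ \<Rightarrow> _ \<Rightarrow> real"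
  assumes "\<And>v v'. bilinear (\<lambda>u u'. B u u' v v')" "\<And>u u'. bilinear (B u u')"
    and e: "orthonormal_frame h e" and e': "orthonormal_frame h e'"
  shows "(\<Sum>a\<in>UNIV. \<Sum>b\<in>UNIV. B (e' a) (e' a) (e' b) (e' b))
       = (\<Sum>a\<in>UNIV. \<Sum>b\<in>UNIV. B (e a) (e a) (e b) (e b))"
proof -
  have "(\<Sum>a\<in>UNIV. \<Sum>b\<in>UNIV. B (e' a) (e' a) (e' b) (e' b))
      = (\<Sum>a\<in>UNIV. \<Sum>b\<in>UNIV. B (e' a) (e' a) (e b) (e b))"
    by (intro sum.cong refl trace_frame_independent assms)
  also have "\<dots> = (\<Sum>b\<in>UNIV. \<Sum>a\<in>UNIV. B (e' a) (e' a) (e b) (e b))"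
    by (rule sum.swap)
  also have "\<dots> = (\<Sum>b\<in>UNIV. \<Sum>a\<in>UNIV. B (e a) (e a) (e b) (e b))"
    by (intro sum.cong refl trace_frame_independent assms)
  also have "\<dots> = (\<Sum>a\<in>UNIV. \<Sum>b\<in>UNIV. B (e a) (e a) (e b) (e b))"
    by (rule sum.swap)
  finally show ?thesis .
qed

text \<open>
If \<open>e\<close> is an orthonormal frame, so is \<open>J e\<close>.
\<close>

lemma trace_J:
  fixes B :: "_ \<Rightarrow> _ \<Rightarrow> real"
  assumes "bilinear B" "orthonormal_frame h e"
  shows "(\<Sum>a\<in>UNIV. B (J (e a)) (J (e a))) = (\<Sum>a\<in>UNIV. B (e a) (e a))"
  using trace_frame_independent[OF assms orthonormal_J[OF assms(2)]] .

end

text \<open>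
The change of the Chern torsion when the metric is multiplied by \<open>e\<^sup>\<phi>\<close> and \<open>l = d\<phi>\<close>. It is the
antisymmetrization of \<open>\<partial>\<phi>(u) v\<close>, where \<open>\<partial>\<phi>(u) = (d\<phi>(u) - \<i> d\<phi>(Ju))/2\<close>.
\<close>

definition conformal_torsion :: "('n::finite cvec \<Rightarrow> real) \<Rightarrow> 'n cvec \<Rightarrow> 'n cvec \<Rightarrow> 'n cvec" where
  "conformal_torsion l u v =
     (1/2) *\<^sub>R (l u *\<^sub>R v - l (J u) *\<^sub>R J v - l v *\<^sub>R u + l (J v) *\<^sub>R J u)"

context hermitian_form
begin

context
  fixes l :: "'n cvec \<Rightarrow> real" and e
  assumes l: "linear l" and e: "orthonormal_frame h e"
begin

lemmas l_simps = linear_add[OF l] linear_scale[OF l] linear_neg[OF l]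

lemma conformal_torsion_bilinear: "bilinear (conformal_torsion l)"
  by (auto simp: bilinear_def conformal_torsion_def l_simps algebra_simps add_divide_distrib intro!: linearI)

lemma trace_conformal_torsion:
  "(\<Sum>a\<in>UNIV. h (conformal_torsion l u (e a)) (e a)) = (real CARD('n) - 1) * l u"
proof -
  have lJ: "linear (\<lambda>v. l (J v))" by (rule linearI) (simp_all add: l_simps)
  have "h (conformal_torsion l u (e a)) (e a) =
      1/2 * (l u - h u (e a) * l (e a) + h (J u) (e a) * l (J (e a)))" for a
    using e by (simp add: conformal_torsion_def h_simps orthonormal_frame_def algebra_simps)
  then have "(\<Sum>a\<in>UNIV. h (conformal_torsion l u (e a)) (e a)) =
      1/2 * ((\<Sum>a\<in>(UNIV::('n+'n) set). l u) - (\<Sum>a\<in>UNIV. h u (e a) * l (e a))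
        + (\<Sum>a\<in>UNIV. h (J u) (e a) * l (J (e a))))"
    by (simp only: sum.distrib sum_subtractf flip: sum_distrib_left)
  then show ?thesis
    using linear_expansion[OF e l, of u] linear_expansion[OF e lJ, of "J u"]
    by (simp add: l_simps algebra_simps)
qed

text \<open>
Only the terms in which \<open>l\<close> is evaluated on the first argument of \<open>T\<close> need to be computed, since
exchanging \<open>a\<close> and \<open>b\<close> yields the others by skew symmetry. The term with \<open>J\<close> equals the term without because \<open>T\<close> is
complex linear and traces are invariant under \<open>J\<close>.
\<close>

lemma sum_inner_conformal_torsion:
  assumes T: "bilinear T" and skew: "\<And>u v. T u v = - T v u" and TJ: "\<And>u v. T (J u) v = J (T u v)"
  shows "(\<Sum>a\<in>UNIV. \<Sum>b\<in>UNIV. h (T (e a) (e b)) (conformal_torsion l (e a) (e b)))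
       = 2 * (\<Sum>a\<in>UNIV. l (e a) * (\<Sum>b\<in>UNIV. h (T (e a) (e b)) (e b)))"
proof -
  let ?tr = "\<lambda>u. \<Sum>b\<in>UNIV. h (T u (e b)) (e b)"
  let ?P = "\<lambda>u v. l u * h (T u v) v + l (J u) * h (T (J u) v) v"
  have "h (T u v) (conformal_torsion l u v) = 1/2 * ?P u v + 1/2 * ?P v u" for u v
    using skew[of v u] by (simp add: conformal_torsion_def h_simps TJ J_skew algebra_simps)
  then have "(\<Sum>a\<in>UNIV. \<Sum>b\<in>UNIV. h (T (e a) (e b)) (conformal_torsion l (e a) (e b)))
      = 1/2 * (\<Sum>a\<in>UNIV. \<Sum>b\<in>UNIV. ?P (e a) (e b)) + 1/2 * (\<Sum>a\<in>UNIV. \<Sum>b\<in>UNIV. ?P (e b) (e a))"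
    by (simp only: sum.distrib flip: sum_distrib_left)
  also have "(\<Sum>a\<in>UNIV. \<Sum>b\<in>UNIV. ?P (e b) (e a)) = (\<Sum>a\<in>UNIV. \<Sum>b\<in>UNIV. ?P (e a) (e b))"
    by (rule sum.swap)
  also have "(\<Sum>a\<in>UNIV. \<Sum>b\<in>UNIV. ?P (e a) (e b)) =
      (\<Sum>a\<in>UNIV. l (e a) * ?tr (e a)) + (\<Sum>a\<in>UNIV. l (J (e a)) * ?tr (J (e a)))"
    by (simp only: sum.distrib sum_distrib_left)
  also have "(\<Sum>a\<in>UNIV. l (J (e a)) * ?tr (J (e a))) = (\<Sum>a\<in>UNIV. l (e a) * ?tr (e a))"
  proof (rule trace_J[of "\<lambda>u v. l u * ?tr v", OF _ e])
    show "bilinear (\<lambda>u v. l u * ?tr v)"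
      by (auto simp: bilinear_def l_simps bilinear_ladd[OF T] bilinear_lmul[OF T] h_simps
          sum.distrib sum_distrib_left algebra_simps intro!: linearI)
  qed
  finally show ?thesis by simp
qed

text \<open>
The conformal torsion is itself skew and complex linear, so the previous formula applies with
\<open>T\<close> equal to it.
\<close>

lemma conformal_torsion_norm_sq:
  "(\<Sum>a\<in>UNIV. \<Sum>b\<in>UNIV. h (conformal_torsion l (e a) (e b)) (conformal_torsion l (e a) (e b)))
   = 2 * (real CARD('n) - 1) * (\<Sum>a\<in>UNIV. (l (e a))\<^sup>2)"
proof -
  have "conformal_torsion l u v = - conformal_torsion l v u"
    "conformal_torsion l (J u) v = J (conformal_torsion l u v)" for u v
    by (simp_all add: conformal_torsion_def l_simps algebra_simps)
  from sum_inner_conformal_torsion[OF conformal_torsion_bilinear this] show ?thesis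
    by (simp add: trace_conformal_torsion power2_eq_square sum_distrib_left sum_subtractf algebra_simps)
qed

end

end

section \<open>The Chern connection of a metric in coordinates\<close>

lemma differentiable_det:
  fixes M :: "'a::real_normed_vector \<Rightarrow> real^'k::finite^'k"
  assumes "\<And>i j. (\<lambda>y. M y $ i $ j) differentiable (at x)"
  shows "(\<lambda>y. det (M y)) differentiable (at x)"
proof -
  have "(\<lambda>y. \<Prod>i\<in>UNIV. M y $ i $ p i) differentiable (at x)" for p
    unfolding differentiable_def
    using has_derivative_prod[of UNIV "\<lambda>i y. M y $ i $ p i" "\<lambda>i. frechet_derivative (\<lambda>y. M y $ i $ p i) (at x)" x UNIV]
      has_frechet_derivative[OF assms] by blast
  then show ?thesis unfolding det_def by (intro derivative_intros) auto
qed

text \<open>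
Vector fields such as \<open>\<Gamma>(u, v)\<close> are given by their inner products with a metric that varies with the
point. In a fixed frame they solve a linear system with differentiable coefficients, and Cramer's
rule expresses the solution by determinants.
\<close>

lemma differentiable_riesz:
  fixes g :: "'n::finite metric"
  assumes S: "open S" "x \<in> S" and form: "\<And>y. y \<in> S \<Longrightarrow> hermitian_form (g y)"
    and g: "\<And>u v. (\<lambda>y. g y u v) differentiable (at x)"
    and k: "\<And>z. (\<lambda>y. k y z) differentiable (at x)"
    and w: "\<And>y z. y \<in> S \<Longrightarrow> g y (w y) z = k y z"
  shows "w differentiable (at x)"
proof -
  interpret H: hermitian_form "g x" using form S by blast
  obtain e where e: "orthonormal_frame (g x) e" using H.orthonormal_frame_exists by blast
  have coeff: "g x (\<Sum>a\<in>UNIV. c a *\<^sub>R e a) (e b) = c b" for c b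
    using e by (simp add: H.h_simps orthonormal_frame_def if_distrib[where f="\<lambda>x. _ * x"] cong: if_cong)
  \<comment> \<open>Gram matrix at \<open>y\<close> of the fixed frame, and its modification in Cramer's rule.\<close>
  define A where "A = (\<lambda>y. (\<chi> a b. g y (e b) (e a)) :: real^('n+'n)^('n+'n))"
  define A' where "A' = (\<lambda>b y. (\<chi> i j. if j = b then k y (e i) else A y $ i $ j) :: real^('n+'n)^('n+'n))"
  have det: "det (A y) \<noteq> 0" if y: "y \<in> S" for y
  proof -
    interpret Y: hermitian_form "g y" using form y by blast
    have "c = 0" if "A y *v c = 0" for c
    proof -
      define v where "v = (\<Sum>b\<in>UNIV. c $ b *\<^sub>R e b)"
      have "g y v (e a) = 0" for a
      proof -
        have "g y v (e a) = (A y *v c) $ a"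
          by (simp add: v_def A_def Y.h_simps matrix_vector_mult_def mult.commute)
        then show ?thesis using that by simp
      qed
      moreover have "g y v v = (\<Sum>b\<in>UNIV. c $ b * g y v (e b))"
        by (subst (2) v_def) (simp add: Y.h_simps)
      ultimately have "v = 0" using Y.pos[of v] by fastforce
      then have "c $ b = 0" for b using coeff[of "\<lambda>b. c $ b" b] by (simp add: v_def H.h_simps)
      then show ?thesis by (simp add: vec_eq_iff)
    qed
    then show ?thesis
      using matrix_left_invertible_ker[of "A y"] invertible_det_nz[of "A y"]
      by (metis invertible_left_inverse)
  qed
  have comp: "g x (w y) (e b) = det (A' b y) / det (A y)" if y: "y \<in> S" for y b
  proof -
    interpret Y: hermitian_form "g y" using form y by blast
    let ?c = "\<chi> b. g x (w y) (e b)"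
    have "(A y *v ?c) $ a = k y (e a)" for a
    proof -
      have "(A y *v ?c) $ a = g y (\<Sum>b\<in>UNIV. g x (w y) (e b) *\<^sub>R e b) (e a)"
        by (simp add: A_def Y.h_simps matrix_vector_mult_def mult.commute)
      then show ?thesis using H.orthonormal_expansion[OF e] w[OF y] by simp
    qed
    then have "A y *v ?c = (\<chi> a. k y (e a))" by (simp add: vec_eq_iff)
    then have "?c = (\<chi> b. det (A' b y) / det (A y))"
      using cramer[OF det[OF y]] by (simp add: A'_def cong: if_cong)
    then show ?thesis by (simp add: vec_eq_iff)
  qed
  show ?thesis
  proof (rule differentiable_cong_open[OF S])
    show "w y = (\<Sum>b\<in>UNIV. (det (A' b y) / det (A y)) *\<^sub>R e b)" if "y \<in> S" for y
      using H.orthonormal_expansion[OF e, of "w y"] comp[OF that] by simp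
    have "(\<lambda>y. A' b y $ i $ j) differentiable (at x)" for b i j
      by (cases "j = b") (simp_all add: A'_def A_def g k)
    then have "(\<lambda>y. det (A' b y) / det (A y)) differentiable (at x)" for b
      by (intro differentiable_divide differentiable_det det[OF S(2)]) (simp_all add: A_def g)
    then show "(\<lambda>y. \<Sum>b\<in>UNIV. (det (A' b y) / det (A y)) *\<^sub>R e b) differentiable (at x)"
      by (intro differentiable_sum differentiable_scaleR differentiable_const) simp_all
  qed
qed

definition metric_deriv :: "'n::finite metric \<Rightarrow> 'n cvec \<Rightarrow> 'n cvec \<Rightarrow> 'n cvec \<Rightarrow> 'n cvec \<Rightarrow> real" where
  "metric_deriv g x u v w = frechet_derivative (\<lambda>y. g y v w) (at x) u"

text \<open>
The zeroth order part of the Chern connection, \<open>D\<^sub>X Y = dY(X) + C(X, Y)\<close>: in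
\<open>g(\<Gamma>(u, v), z) - 1/2 d\<omega>(Ju, v, z)\<close> all terms with derivatives along \<open>v\<close> or \<open>z\<close> cancel.
\<close>

definition chern_coeff :: "'n::finite metric \<Rightarrow> 'n cvec \<Rightarrow> 'n cvec \<Rightarrow> 'n cvec \<Rightarrow> 'n cvec" where
  "chern_coeff g x u v = (THE c. \<forall>z.
     g x c z = 1/2 * (metric_deriv g x u v z - metric_deriv g x (J u) (J v) z))"

locale hermitian_domain =
  fixes S :: "'n::finite cvec set" and g :: "'n metric"
  assumes open_S: "open S"
    and smooth: "\<And>u v. smooth_on S (\<lambda>x. g x u v)"
    and form: "\<And>x. x \<in> S \<Longrightarrow> hermitian_form (g x)"
begin

lemma g_differentiable: "x \<in> S \<Longrightarrow> (\<lambda>y. g y u v) differentiable (at x)"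
  using smooth_on_differentiable[OF smooth] .

lemma metric_deriv_differentiable: "x \<in> S \<Longrightarrow> (\<lambda>y. metric_deriv g y u v w) differentiable (at x)"
  unfolding metric_deriv_def
  using smooth_on_differentiable[OF smooth_on_frechet_derivative[OF smooth]] .

context
  fixes x assumes x: "x \<in> S"
begin

interpretation H: hermitian_form "g x" by (rule form[OF x])

lemma metric_deriv_linear:
  "linear (\<lambda>u. metric_deriv g x u v w)"
  "linear (\<lambda>v. metric_deriv g x u v w)"
  "linear (\<lambda>w. metric_deriv g x u v w)"
  unfolding metric_deriv_def
  using linear_frechet_derivative[OF g_differentiable[OF x]]
    linear_frechet_derivative_param[OF open_S x g_differentiable[OF x] hermitian_form.lin_left[OF form]]
    linear_frechet_derivative_param[OF open_S x g_differentiable[OF x] hermitian_form.lin_right[OF form]]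
  by auto

lemmas metric_deriv_simps =
  linear_add[OF metric_deriv_linear(1)] linear_add[OF metric_deriv_linear(2)] linear_add[OF metric_deriv_linear(3)]
  linear_scale[OF metric_deriv_linear(1)] linear_scale[OF metric_deriv_linear(2)] linear_scale[OF metric_deriv_linear(3)]
  linear_neg[OF metric_deriv_linear(1)] linear_neg[OF metric_deriv_linear(2)] linear_neg[OF metric_deriv_linear(3)]
  linear_0[OF metric_deriv_linear(1)] linear_0[OF metric_deriv_linear(2)] linear_0[OF metric_deriv_linear(3)]

lemma metric_deriv_sym: "metric_deriv g x u v w = metric_deriv g x u w v"
  unfolding metric_deriv_def
  using frechet_derivative_cong_open[OF open_S x hermitian_form.sym[OF form] g_differentiable[OF x]] .

lemma metric_deriv_J_J: "metric_deriv g x u (J v) (J w) = metric_deriv g x u v w"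
  unfolding metric_deriv_def
  using frechet_derivative_cong_open[OF open_S x hermitian_form.J_J_eq[OF form] g_differentiable[OF x]] .

lemma metric_deriv_J: "metric_deriv g x u (J v) w = - metric_deriv g x u v (J w)"
  using metric_deriv_J_J[of u v "J w"] by (simp add: metric_deriv_simps)

lemma chern_coeff_char:
  "g x (chern_coeff g x u v) z = 1/2 * (metric_deriv g x u v z - metric_deriv g x (J u) (J v) z)"
proof -
  have "linear (\<lambda>z. 1/2 * (metric_deriv g x u v z - metric_deriv g x (J u) (J v) z))"
    by (rule linearI) (simp_all add: metric_deriv_simps algebra_simps)
  then obtain c where c: "\<forall>z. g x c z = 1/2 * (metric_deriv g x u v z - metric_deriv g x (J u) (J v) z)"
    using H.riesz by blast
  have "chern_coeff g x u v = c"
    unfolding chern_coeff_def by (rule the_equality) (use c in \<open>metis H.eqI\<close>)+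
  then show ?thesis using c by blast
qed

lemma chern_coeff_bilinear: "bilinear (chern_coeff g x)"
  unfolding bilinear_def
  by (auto intro!: linearI H.eqI simp: chern_coeff_char metric_deriv_simps H.h_simps algebra_simps)

text \<open>
Together with \<open>chern_coeff_J_left\<close> this is complex bilinearity: \<open>J\<close> is parallel, and the torsion has
no part of type \<open>(1,1)\<close>.
\<close>

lemma chern_coeff_J_right: "chern_coeff g x u (J v) = J (chern_coeff g x u v)"
  by (rule H.eqI)
     (simp add: chern_coeff_char H.J_skew metric_deriv_J metric_deriv_J_J metric_deriv_simps field_simps)

lemma chern_coeff_J_left: "chern_coeff g x (J u) v = J (chern_coeff g x u v)"
  by (rule H.eqI)
     (simp add: chern_coeff_char H.J_skew metric_deriv_J metric_deriv_J_J metric_deriv_simps field_simps)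

lemmas chern_coeff_simps =
  bilinear_ladd[OF chern_coeff_bilinear] bilinear_radd[OF chern_coeff_bilinear]
  bilinear_lmul[OF chern_coeff_bilinear] bilinear_rmul[OF chern_coeff_bilinear]
  bilinear_lneg[OF chern_coeff_bilinear] bilinear_rneg[OF chern_coeff_bilinear]
  bilinear_lsub[OF chern_coeff_bilinear] bilinear_rsub[OF chern_coeff_bilinear]
  bilinear_lzero[OF chern_coeff_bilinear] bilinear_rzero[OF chern_coeff_bilinear]
  chern_coeff_J_left chern_coeff_J_right

lemma ext_deriv2_eq:
  "ext_deriv2 (fundamental_form g) x a b c =
    metric_deriv g x a (J b) c - metric_deriv g x b (J a) c + metric_deriv g x c (J a) b"
  by (simp add: ext_deriv2_def fundamental_form_def metric_deriv_def)

text \<open>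
Koszul's formula. The right-hand side is linear in \<open>w\<close>, so it defines a candidate, and it is forced
by symmetry and metric compatibility.
\<close>

lemma christoffel_char:
  "g x (christoffel g x u v) w =
    1/2 * (metric_deriv g x u v w + metric_deriv g x v u w - metric_deriv g x w u v)"
proof -
  let ?k = "\<lambda>u v w. 1/2 * (metric_deriv g x u v w + metric_deriv g x v u w - metric_deriv g x w u v)"
  let ?P = "\<lambda>\<Gamma>. bilinear \<Gamma> \<and> (\<forall>u v. \<Gamma> u v = \<Gamma> v u) \<and>
     (\<forall>u v w. frechet_derivative (\<lambda>y. g y v w) (at x) u = g x (\<Gamma> u v) w + g x v (\<Gamma> u w))"
  have "linear (?k u v)" for u v
    by (rule linearI) (simp_all add: metric_deriv_simps algebra_simps)
  then have "\<exists>c. \<forall>w. g x c w = ?k u v w" for u v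
    using H.riesz by blast
  then obtain \<Gamma> where \<Gamma>: "\<And>u v w. g x (\<Gamma> u v) w = ?k u v w" by metis
  have "?P \<Gamma>"
  proof (intro conjI allI)
    show "bilinear \<Gamma>"
      unfolding bilinear_def
      by (auto intro!: linearI H.eqI simp: \<Gamma> metric_deriv_simps H.h_simps algebra_simps)
    show "\<Gamma> u v = \<Gamma> v u" for u v
      by (rule H.eqI) (simp add: \<Gamma> metric_deriv_sym[of _ u v])
    show "frechet_derivative (\<lambda>y. g y v w) (at x) u = g x (\<Gamma> u v) w + g x v (\<Gamma> u w)" for u v w
      using metric_deriv_sym[of u v w] metric_deriv_sym[of w u v] metric_deriv_sym[of v u w]
      by (simp add: H.sym[of v] \<Gamma> field_simps flip: metric_deriv_def)
  qed
  moreover have "\<Gamma>' = \<Gamma>" if "?P \<Gamma>'" for \<Gamma>'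
  proof (intro ext H.eqI)
    fix u v w
    have s: "\<Gamma>' u v = \<Gamma>' v u" and m: "metric_deriv g x u v w = g x (\<Gamma>' u v) w + g x v (\<Gamma>' u w)" for u v w
      using that by (auto simp: metric_deriv_def)
    show "g x (\<Gamma>' u v) w = g x (\<Gamma> u v) w"
      unfolding \<Gamma> m
      using s[of u v] s[of u w] s[of v w] H.sym[of "\<Gamma>' u w" v] H.sym[of "\<Gamma>' v w" u] H.sym[of "\<Gamma>' w u" v] H.sym[of "\<Gamma>' w v" u]
      by simp
  qed
  ultimately have "christoffel g x = \<Gamma>"
    unfolding christoffel_def by (rule the_equality)
  then show ?thesis using \<Gamma> by simp
qed

lemma levi_civita_const: "levi_civita g (\<lambda>_. u) (\<lambda>_. v) x = christoffel g x u v"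
  by (simp add: levi_civita_def)

lemma chern_connection_eq:
  "chern_connection g X Y x = frechet_derivative Y (at x) (X x) + chern_coeff g x (X x) (Y x)"
  unfolding chern_connection_def
proof (rule the_equality)
  show "\<forall>z. g x (frechet_derivative Y (at x) (X x) + chern_coeff g x (X x) (Y x)) z =
      g x (levi_civita g X Y x) z - 1/2 * ext_deriv2 (fundamental_form g) x (J (X x)) (Y x) z"
    by (simp add: levi_civita_def H.h_simps chern_coeff_char christoffel_char ext_deriv2_eq
        metric_deriv_simps field_simps)
  then show "w = frechet_derivative Y (at x) (X x) + chern_coeff g x (X x) (Y x)"
    if "\<forall>z. g x w z = g x (levi_civita g X Y x) z - 1/2 * ext_deriv2 (fundamental_form g) x (J (X x)) (Y x) z" for w
    using that by (intro H.eqI) simp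
qed

lemma chern_torsion_eq: "chern_torsion g x u v = chern_coeff g x u v - chern_coeff g x v u"
  unfolding chern_torsion_def
proof (rule the_equality)
  show c: "\<forall>z. - 2 * g x (chern_coeff g x u v - chern_coeff g x v u) z =
     ext_deriv2 (fundamental_form g) x (J u) v z + ext_deriv2 (fundamental_form g) x u (J v) z"
    by (simp add: H.h_simps chern_coeff_char ext_deriv2_eq metric_deriv_simps metric_deriv_J_J field_simps)
  show "w = chern_coeff g x u v - chern_coeff g x v u"
    if "\<forall>z. - 2 * g x w z = ext_deriv2 (fundamental_form g) x (J u) v z + ext_deriv2 (fundamental_form g) x u (J v) z" for w
    using that c by (intro H.eqI) (metis mult_cancel_left neg_equal_0_iff_equal zero_neq_numeral)
qed

lemma chern_coeff_differentiable: "(\<lambda>y. chern_coeff g y u v) differentiable (at x)"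
proof (rule differentiable_riesz[OF open_S x form g_differentiable[OF x]])
  show "(\<lambda>y. 1/2 * (metric_deriv g y u v z - metric_deriv g y (J u) (J v) z)) differentiable (at x)" for z
    by (intro derivative_intros metric_deriv_differentiable x)
qed (auto simp: hermitian_domain.chern_coeff_char[OF hermitian_domain_axioms])

end

end

section \<open>Traces of torsion and curvature\<close>

lemma sum_UNIV_sum_type:
  fixes F :: "'i::finite + 'j::finite \<Rightarrow> 'b::comm_monoid_add"
  shows "(\<Sum>a\<in>UNIV. F a) = (\<Sum>i\<in>UNIV. F (Inl i)) + (\<Sum>j\<in>UNIV. F (Inr j))"
  using sum.Plus[of "UNIV :: 'i set" "UNIV :: 'j set" F] by simp

text \<open>
The Chern curvature operator on constant vector fields.
\<close>

definition chern_op :: "'n::finite metric \<Rightarrow> 'n cvec \<Rightarrow> 'n cvec \<Rightarrow> 'n cvec \<Rightarrow> 'n cvec \<Rightarrow> 'n cvec" where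
  "chern_op g x X Y Z =
     frechet_derivative (\<lambda>y. chern_coeff g y Y Z) (at x) X
   - frechet_derivative (\<lambda>y. chern_coeff g y X Z) (at x) Y
   + chern_coeff g x X (chern_coeff g x Y Z) - chern_coeff g x Y (chern_coeff g x X Z)"

context hermitian_domain
begin

context
  fixes x assumes x: "x \<in> S"
begin

interpretation H: hermitian_form "g x" by (rule form[OF x])

lemma some_frame: "orthonormal_frame (g x) (some_orthonormal_frame g x)"
  unfolding some_orthonormal_frame_def using H.orthonormal_frame_exists by (rule someI_ex)

lemma some_unitary: "unitary_frame (g x) (some_unitary_frame g x)"
  unfolding some_unitary_frame_def using H.unitary_frame_exists by (rule someI_ex)

lemma chern_torsion_bilinear: "bilinear (chern_torsion g x)"
  unfolding bilinear_def
  by (auto intro!: linearI simp: chern_torsion_eq[OF x] chern_coeff_simps[OF x] algebra_simps)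

lemmas chern_torsion_simps =
  bilinear_ladd[OF chern_torsion_bilinear] bilinear_radd[OF chern_torsion_bilinear]
  bilinear_lmul[OF chern_torsion_bilinear] bilinear_rmul[OF chern_torsion_bilinear]
  bilinear_lneg[OF chern_torsion_bilinear] bilinear_rneg[OF chern_torsion_bilinear]

lemma chern_torsion_skew: "chern_torsion g x u v = - chern_torsion g x v u"
  by (simp add: chern_torsion_eq[OF x])

lemma chern_torsion_J: "chern_torsion g x (J u) v = J (chern_torsion g x u v)"
  by (simp add: chern_torsion_eq[OF x] chern_coeff_simps[OF x])

lemma lee_form_Basis: "lee_form g x u = (\<Sum>b\<in>Basis. chern_torsion g x u b \<bullet> b)"
proof -
  have "linear (chern_torsion g x u)" using chern_torsion_bilinear by (simp add: bilinear_def)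
  from H.trace_eq_sum_Basis[OF some_frame this] show ?thesis
    by (simp add: lee_form_def Let_def)
qed

lemma lee_form_eq:
  assumes e: "orthonormal_frame (g x) e"
  shows "lee_form g x u = (\<Sum>a\<in>UNIV. g x (chern_torsion g x u (e a)) (e a))"
proof -
  have "linear (chern_torsion g x u)" using chern_torsion_bilinear by (simp add: bilinear_def)
  from H.trace_eq_sum_Basis[OF e this] show ?thesis
    by (simp add: lee_form_Basis)
qed

lemma linear_lee_form: "linear (lee_form g x)"
  by (rule linearI)
     (simp_all add: lee_form_Basis chern_torsion_simps inner_add_left sum.distrib sum_distrib_left)

lemma lee_form_differentiable: "(\<lambda>y. lee_form g y u) differentiable (at x)"
proof (rule differentiable_cong_open[OF open_S x])
  show "lee_form g y u = (\<Sum>b\<in>Basis. (chern_coeff g y u b - chern_coeff g y b u) \<bullet> b)" if "y \<in> S" for y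
    using hermitian_domain.lee_form_Basis[OF hermitian_domain_axioms that]
      chern_torsion_eq[OF that] by simp
  show "(\<lambda>y. \<Sum>b\<in>Basis. (chern_coeff g y u b - chern_coeff g y b u) \<bullet> b) differentiable (at x)"
    by (intro differentiable_sum ballI differentiable_inner differentiable_diff differentiable_const
        chern_coeff_differentiable x) simp
qed

lemma torsion_norm_sq_eq:
  assumes e: "orthonormal_frame (g x) e"
  shows "torsion_norm_sq g x = (\<Sum>a\<in>UNIV. \<Sum>b\<in>UNIV.
    g x (chern_torsion g x (e a) (e b)) (chern_torsion g x (e a) (e b)))"
proof -
  let ?B = "\<lambda>u u' v v'. g x (chern_torsion g x u v) (chern_torsion g x u' v')"
  have "bilinear (\<lambda>u u'. ?B u u' v v')" for v v'
    by (auto simp: bilinear_def chern_torsion_simps H.h_simps intro!: linearI)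
  moreover have "bilinear (?B u u')" for u u'
    by (auto simp: bilinear_def chern_torsion_simps H.h_simps intro!: linearI)
  ultimately show ?thesis
    unfolding torsion_norm_sq_def Let_def
    by (rule H.double_trace_frame_independent[OF _ _ e some_frame])
qed

text \<open>
In both sides only first derivatives of \<open>g\<close> occur. The terms \<open>(\<partial>\<^bsub>Jz\<^esub> g)(Je, e)\<close> vanish, because
\<open>g(Je, e) = 0\<close> identically, and \<open>(\<partial>\<^bsub>Je\<^esub> g)(Je, z)\<close> has the same trace as \<open>(\<partial>\<^sub>e g)(e, z)\<close>.
\<close>

lemma trace_christoffel:
  assumes e: "orthonormal_frame (g x) e"
  shows "(\<Sum>a\<in>UNIV. g x (christoffel g x (e a) (e a)) z) = - lee_form g x z"
proof -
  have B: "bilinear (\<lambda>u v. metric_deriv g x u v z)"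
    unfolding bilinear_def using metric_deriv_linear[OF x] by blast
  have "2 * g x (chern_torsion g x z (e a)) (e a) = metric_deriv g x z (e a) (e a)
      - metric_deriv g x (e a) (e a) z - metric_deriv g x (J (e a)) (J (e a)) z" for a
  proof -
    have "metric_deriv g x u (J (e a)) (e a) = 0" for u
      using metric_deriv_J[OF x, of u "e a" "e a"] metric_deriv_sym[OF x, of u "J (e a)" "e a"] by simp
    moreover have "metric_deriv g x u (J z) (e a) = - metric_deriv g x u (J (e a)) z" for u
      using metric_deriv_J[OF x, of u z "e a"] metric_deriv_sym[OF x, of u z "J (e a)"] by simp
    ultimately show ?thesis
      by (simp add: chern_torsion_eq[OF x] H.h_simps chern_coeff_char[OF x]
          metric_deriv_sym[OF x, of "e a" z] field_simps)
  qed
  then have "(\<Sum>a\<in>UNIV. 2 * g x (chern_torsion g x z (e a)) (e a)) =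
      (\<Sum>a\<in>UNIV. metric_deriv g x z (e a) (e a)) - (\<Sum>a\<in>UNIV. metric_deriv g x (e a) (e a) z)
      - (\<Sum>a\<in>UNIV. metric_deriv g x (J (e a)) (J (e a)) z)"
    by (simp add: sum_subtractf)
  then have "2 * lee_form g x z = (\<Sum>a\<in>UNIV. metric_deriv g x z (e a) (e a))
      - 2 * (\<Sum>a\<in>UNIV. metric_deriv g x (e a) (e a) z)"
    using H.trace_J[OF B e] by (simp add: lee_form_eq[OF e] flip: sum_distrib_left)
  moreover have "2 * (\<Sum>a\<in>UNIV. g x (christoffel g x (e a) (e a)) z) =
      2 * (\<Sum>a\<in>UNIV. metric_deriv g x (e a) (e a) z) - (\<Sum>a\<in>UNIV. metric_deriv g x z (e a) (e a))"
  proof -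
    have "2 * g x (christoffel g x (e a) (e a)) z =
        2 * metric_deriv g x (e a) (e a) z - metric_deriv g x z (e a) (e a)" for a
      by (simp add: christoffel_char[OF x] field_simps)
    then show ?thesis by (simp add: sum_distrib_left sum_subtractf)
  qed
  ultimately show ?thesis by simp
qed

lemma christoffel_bilinear: "bilinear (christoffel g x)"
  unfolding bilinear_def
  by (auto intro!: linearI H.eqI simp: christoffel_char[OF x] metric_deriv_simps[OF x] H.h_simps algebra_simps)

text \<open>
By \<open>trace_christoffel\<close> the Christoffel symbols contribute \<open>\<theta>(\<Sum> \<Gamma>(e, e)) = - |\<theta>|\<^sup>2\<close>. In this form the
behaviour under a conformal change is governed by the Lee form alone.
\<close>

lemma codifferential_lee_form:
  assumes e: "orthonormal_frame (g x) e"
  shows "codifferential g (lee_form g) x =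
    - (\<Sum>a\<in>UNIV. frechet_derivative (\<lambda>y. lee_form g y (e a)) (at x) (e a) + (lee_form g x (e a))\<^sup>2)"
proof -
  let ?B = "\<lambda>u v. frechet_derivative (\<lambda>y. lee_form g y v) (at x) u - lee_form g x (christoffel g x u v)"
  note ll = linear_add[OF linear_lee_form] linear_scale[OF linear_lee_form]
  have l1: "linear (\<lambda>u. frechet_derivative (\<lambda>y. lee_form g y v) (at x) u)" for v
    using linear_frechet_derivative[OF lee_form_differentiable] by simp
  have l2: "linear (\<lambda>v. frechet_derivative (\<lambda>y. lee_form g y v) (at x) u)" for u
    by (rule linear_frechet_derivative_param[OF open_S x lee_form_differentiable
        hermitian_domain.linear_lee_form[OF hermitian_domain_axioms]])
  have "bilinear ?B"
    unfolding bilinear_def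
    by (auto intro!: linearI simp: linear_add[OF l1] linear_add[OF l2] linear_scale[OF l1] linear_scale[OF l2]
        ll bilinear_ladd[OF christoffel_bilinear] bilinear_radd[OF christoffel_bilinear]
        bilinear_lmul[OF christoffel_bilinear] bilinear_rmul[OF christoffel_bilinear] algebra_simps)
  from H.trace_frame_independent[OF this e some_frame]
  have "codifferential g (lee_form g) x = - (\<Sum>a\<in>UNIV. ?B (e a) (e a))"
    by (simp add: codifferential_def Let_def levi_civita_form_def levi_civita_const[OF x])
  moreover have "(\<Sum>a\<in>UNIV. lee_form g x (christoffel g x (e a) (e a))) = - (\<Sum>a\<in>UNIV. (lee_form g x (e a))\<^sup>2)"
  proof -
    have w: "lee_form g x w = (\<Sum>b\<in>UNIV. g x w (e b) * lee_form g x (e b))" for w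
      using H.linear_expansion[OF e linear_lee_form, of w] by simp
    have "(\<Sum>a\<in>UNIV. lee_form g x (christoffel g x (e a) (e a))) =
       (\<Sum>a\<in>UNIV. \<Sum>b\<in>UNIV. g x (christoffel g x (e a) (e a)) (e b) * lee_form g x (e b))"
      by (intro sum.cong refl w)
    also have "\<dots> = (\<Sum>b\<in>UNIV. (\<Sum>a\<in>UNIV. g x (christoffel g x (e a) (e a)) (e b)) * lee_form g x (e b))"
      by (subst sum.swap) (simp add: sum_distrib_right)
    finally show ?thesis
      by (simp add: trace_christoffel[OF e] power2_eq_square sum_negf)
  qed
  ultimately show ?thesis by (simp add: sum.distrib sum_subtractf)
qed

lemma chern_curvature_const:
  "chern_curvature g (\<lambda>_. X) (\<lambda>_. Y) (\<lambda>_. Z) (\<lambda>_. W) x = g x (chern_op g x X Y Z) W"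
proof -
  have c: "chern_connection g (\<lambda>_. Y) (\<lambda>_. Z) y = chern_coeff g y Y Z" if "y \<in> S" for y Y
    by (simp add: chern_connection_eq[OF that])
  have "chern_connection g (\<lambda>_. X) (chern_connection g (\<lambda>_. Y) (\<lambda>_. Z)) x =
      frechet_derivative (\<lambda>y. chern_coeff g y Y Z) (at x) X + chern_coeff g x X (chern_coeff g x Y Z)" for X Y
    using frechet_derivative_cong_open[OF open_S x c chern_coeff_differentiable[OF x]]
    by (simp add: chern_connection_eq[OF x] c[OF x])
  moreover have "lie_bracket (\<lambda>_. X) (\<lambda>_. Y) = (\<lambda>_. 0)"
    by (simp add: lie_bracket_def fun_eq_iff)
  moreover have "chern_connection g (\<lambda>_. 0) (\<lambda>_. Z) x = 0"
    by (simp add: c[OF x] chern_coeff_simps[OF x])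
  ultimately show ?thesis
    by (simp add: chern_curvature_def chern_op_def algebra_simps)
qed

lemma frechet_derivative_chern_coeff_linear:
  "linear (\<lambda>X. frechet_derivative (\<lambda>y. chern_coeff g y Y Z) (at x) X)"
  "linear (\<lambda>Y. frechet_derivative (\<lambda>y. chern_coeff g y Y Z) (at x) X)"
  "linear (\<lambda>Z. frechet_derivative (\<lambda>y. chern_coeff g y Y Z) (at x) X)"
proof -
  show "linear (\<lambda>X. frechet_derivative (\<lambda>y. chern_coeff g y Y Z) (at x) X)"
    by (rule linear_frechet_derivative[OF chern_coeff_differentiable[OF x]])
  show "linear (\<lambda>Y. frechet_derivative (\<lambda>y. chern_coeff g y Y Z) (at x) X)"
    by (rule linear_frechet_derivative_param[OF open_S x chern_coeff_differentiable[OF x]])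
       (use chern_coeff_bilinear in \<open>auto simp: bilinear_def\<close>)
  show "linear (\<lambda>Z. frechet_derivative (\<lambda>y. chern_coeff g y Y Z) (at x) X)"
    by (rule linear_frechet_derivative_param[OF open_S x chern_coeff_differentiable[OF x]])
       (use chern_coeff_bilinear in \<open>auto simp: bilinear_def\<close>)
qed

lemma frechet_derivative_chern_coeff_J:
  "frechet_derivative (\<lambda>y. chern_coeff g y Y (J Z)) (at x) X
    = J (frechet_derivative (\<lambda>y. chern_coeff g y Y Z) (at x) X)"
proof -
  have b: "bounded_linear J" using linear_J by (simp add: linear_conv_bounded_linear)
  have d: "((\<lambda>y. J (chern_coeff g y Y Z)) has_derivative
      (\<lambda>X. J (frechet_derivative (\<lambda>y. chern_coeff g y Y Z) (at x) X))) (at x)"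
    using bounded_linear.has_derivative[OF b has_frechet_derivative[OF chern_coeff_differentiable[OF x]]] .
  then have "(\<lambda>y. J (chern_coeff g y Y Z)) differentiable (at x)" by (auto simp: differentiable_def)
  from frechet_derivative_cong_open[OF open_S x chern_coeff_J_right this] frechet_derivative_eqI[OF d]
  show ?thesis by simp
qed

lemma chern_op_J: "chern_op g x X Y (J Z) = J (chern_op g x X Y Z)"
  by (simp add: chern_op_def frechet_derivative_chern_coeff_J chern_coeff_simps[OF x])

lemma chern_op_skew: "chern_op g x X Y Z = - chern_op g x Y X Z"
  by (simp add: chern_op_def)

lemma chern_op_linear:
  "linear (\<lambda>X. chern_op g x X Y Z)" "linear (\<lambda>Y. chern_op g x X Y Z)" "linear (\<lambda>Z. chern_op g x X Y Z)"
proof -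
  have c: "linear (\<lambda>u. chern_coeff g x u v)" "linear (\<lambda>u. chern_coeff g x v u)"
    "linear (\<lambda>u. chern_coeff g x v (chern_coeff g x u w))"
    "linear (\<lambda>u. chern_coeff g x v (chern_coeff g x w u))" for v w
    by (auto intro!: linearI simp: chern_coeff_simps[OF x])
  show "linear (\<lambda>X. chern_op g x X Y Z)" "linear (\<lambda>Y. chern_op g x X Y Z)" "linear (\<lambda>Z. chern_op g x X Y Z)"
    unfolding chern_op_def
    by (intro linear_compose_add linear_compose_sub frechet_derivative_chern_coeff_linear c)+
qed

text \<open>
A unitary frame \<open>f\<close> gives the orthonormal frame formed by \<open>f\<close> and \<open>J f\<close>. Since the summand is invariant under \<open>J\<close>
in either argument, the double sum over this frame is four times the sum over \<open>f\<close>. This turns the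
unitary traces into real ones, which do not depend on the frame.
\<close>

lemma chern_scalar_curvature_eq:
  assumes e: "orthonormal_frame (g x) e"
  shows "chern_scalar_curvature g x =
    - 1/2 * (\<Sum>a\<in>UNIV. \<Sum>b\<in>UNIV. g x (chern_op g x (e a) (J (e a)) (e b)) (J (e b)))"
proof -
  let ?Q = "\<lambda>u v. g x (chern_op g x u (J u) v) (J v)"
  define f where "f = some_unitary_frame g x"
  define f' where "f' = case_sum f (J \<circ> f)"
  have f': "orthonormal_frame (g x) f'"
    unfolding f'_def f_def by (rule H.orthonormal_of_unitary[OF some_unitary])
  have QJ: "?Q (J u) v = ?Q u v" "?Q u (J v) = ?Q u v" for u v
    using chern_op_skew[of "J u" "J (J u)" v] linear_neg[OF chern_op_linear(1), of u "J u" v]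
    by (simp_all add: chern_op_J H.J_skew H.h_simps)
  have s: "?Q u (f' (Inl j)) = ?Q u (f j)" "?Q u (f' (Inr j)) = ?Q u (f j)"
    "?Q (f' (Inl j)) u = ?Q (f j) u" "?Q (f' (Inr j)) u = ?Q (f j) u" for u j
    using QJ by (simp_all add: f'_def)
  have "(\<Sum>a\<in>UNIV. \<Sum>b\<in>UNIV. ?Q (f' a) (f' b)) = 4 * (\<Sum>i\<in>UNIV. \<Sum>j\<in>UNIV. ?Q (f i) (f j))"
    by (simp only: sum_UNIV_sum_type s) (simp add: sum.distrib flip: sum_distrib_left)
  moreover have "(\<Sum>a\<in>UNIV. \<Sum>b\<in>UNIV. ?Q (f' a) (f' b)) = (\<Sum>a\<in>UNIV. \<Sum>b\<in>UNIV. ?Q (e a) (e b))"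
  proof -
    let ?B = "\<lambda>u u' v v'. g x (chern_op g x u (J u') v) (J v')"
    note l = linear_add[OF chern_op_linear(1)] linear_add[OF chern_op_linear(2)]
        linear_add[OF chern_op_linear(3)] linear_scale[OF chern_op_linear(1)]
        linear_scale[OF chern_op_linear(2)] linear_scale[OF chern_op_linear(3)]
    have "bilinear (\<lambda>u u'. ?B u u' v v')" for v v'
      by (auto simp: bilinear_def l H.h_simps intro!: linearI)
    moreover have "bilinear (?B u u')" for u u'
      by (auto simp: bilinear_def l H.h_simps intro!: linearI)
    ultimately show ?thesis
      by (rule H.double_trace_frame_independent[OF _ _ e f'])
  qed
  ultimately show ?thesis
    by (simp add: chern_scalar_curvature_def Let_def chern_curvature_const flip: f_def)
qed

end

end

section \<open>Conformal change of the metric\<close>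

locale conformal_domain =
  G: hermitian_domain S g + G': hermitian_domain S g'
  for S :: "'n::finite cvec set" and g g' :: "'n metric" +
  fixes \<phi> :: "'n cvec \<Rightarrow> real"
  assumes phi: "smooth_on S \<phi>"
    and conf: "x \<in> S \<Longrightarrow> g' x u v = exp (\<phi> x) * g x u v"
begin

abbreviation d\<phi> where "d\<phi> x \<equiv> frechet_derivative \<phi> (at x)"

context
  fixes x assumes x: "x \<in> S"
begin

interpretation H: hermitian_form "g x" by (rule G.form[OF x])
interpretation H': hermitian_form "g' x" by (rule G'.form[OF x])

lemma linear_dphi: "linear (d\<phi> x)"
  using linear_frechet_derivative[OF smooth_on_differentiable[OF phi x]] .

lemmas hess_simps =
  linear_add[OF linear_hess(1)[OF G.open_S x phi]] linear_scale[OF linear_hess(1)[OF G.open_S x phi]]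
  linear_neg[OF linear_hess(1)[OF G.open_S x phi]]
  linear_add[OF linear_hess(2)[OF G.open_S x phi]] linear_scale[OF linear_hess(2)[OF G.open_S x phi]]
  linear_neg[OF linear_hess(2)[OF G.open_S x phi]]

lemma hess_phi_bilinear: "bilinear (hess \<phi> x)"
  using linear_hess[OF G.open_S x phi] by (simp add: bilinear_def)

lemma metric_deriv_conformal:
  "metric_deriv g' x u v w = exp (\<phi> x) * (d\<phi> x u * g x v w + metric_deriv g x u v w)"
proof -
  have D: "((\<lambda>y. exp (\<phi> y) * g y v w) has_derivative
      (\<lambda>u. exp (\<phi> x) * (d\<phi> x u * g x v w + metric_deriv g x u v w))) (at x)"
    unfolding metric_deriv_def
    by (rule derivative_eq_intros has_frechet_derivative[OF smooth_on_differentiable[OF phi x]]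
        has_frechet_derivative[OF G.g_differentiable[OF x]] refl)+ (simp add: algebra_simps)
  then have "(\<lambda>y. exp (\<phi> y) * g y v w) differentiable (at x)"
    by (auto simp: differentiable_def)
  from frechet_derivative_cong_open[OF G.open_S x conf this] frechet_derivative_eqI[OF D]
  show ?thesis unfolding metric_deriv_def[of g'] by (rule trans)
qed

text \<open>
The added term is \<open>\<partial>\<phi>(u) v\<close>, multiplication by a complex scalar.
\<close>

lemma chern_coeff_conformal:
  "chern_coeff g' x u v = chern_coeff g x u v + (1/2 * d\<phi> x u) *\<^sub>R v - (1/2 * d\<phi> x (J u)) *\<^sub>R J v"
  by (rule H'.eqI)
     (simp only: G'.chern_coeff_char[OF x] metric_deriv_conformal, simp add: conf[OF x]
       H.h_simps G.chern_coeff_char[OF x] field_simps)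

lemma chern_torsion_conformal:
  "chern_torsion g' x u v = chern_torsion g x u v + conformal_torsion (d\<phi> x) u v"
  by (simp add: G'.chern_torsion_eq[OF x] G.chern_torsion_eq[OF x] chern_coeff_conformal
      conformal_torsion_def algebra_simps)

text \<open>
Both Lee forms are traces in the standard basis, so their difference is the trace of \<open>conformal_torsion\<close>.
\<close>

lemma lee_form_conformal: "lee_form g' x u = lee_form g x u + (real CARD('n) - 1) * d\<phi> x u"
proof -
  have "linear (chern_torsion g' x u)" using G'.chern_torsion_bilinear[OF x] by (simp add: bilinear_def)
  obtain e where e: "orthonormal_frame (g x) e" using H.orthonormal_frame_exists by blast
  from H.trace_eq_sum_Basis[OF e \<open>linear (chern_torsion g' x u)\<close>]
  have "lee_form g' x u = (\<Sum>a\<in>UNIV. g x (chern_torsion g' x u (e a)) (e a))"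
    by (simp add: G'.lee_form_Basis[OF x])
  then show ?thesis
    using H.trace_conformal_torsion[OF linear_dphi e, of u]
    by (simp add: chern_torsion_conformal H.h_simps sum.distrib G.lee_form_eq[OF x e])
qed

lemma dphi_differentiable: "(\<lambda>y. frechet_derivative \<phi> (at y) v) differentiable (at x)"
  using smooth_on_differentiable[OF smooth_on_frechet_derivative[OF phi] x] .

text \<open>
The terms that are linear in \<open>d\<phi>\<close> cancel because \<open>C\<close> is complex linear in its second argument, and the
quadratic ones because complex scalars commute. What remains is \<open>d(\<partial>\<phi>)\<close>.
\<close>

lemma chern_op_conformal:
  "chern_op g' x X Y Z = chern_op g x X Y Z
    + (1/2 * (hess \<phi> x X Y - hess \<phi> x Y X)) *\<^sub>R Z
    - (1/2 * (hess \<phi> x X (J Y) - hess \<phi> x Y (J X))) *\<^sub>R J Z"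
proof -
  have d: "frechet_derivative (\<lambda>y. chern_coeff g' y Y Z) (at x) X =
      frechet_derivative (\<lambda>y. chern_coeff g y Y Z) (at x) X
      + (1/2 * hess \<phi> x X Y) *\<^sub>R Z - (1/2 * hess \<phi> x X (J Y)) *\<^sub>R J Z" for X Y
  proof -
    let ?k = "\<lambda>y. chern_coeff g y Y Z + (1/2 * frechet_derivative \<phi> (at y) Y) *\<^sub>R Z
        - (1/2 * frechet_derivative \<phi> (at y) (J Y)) *\<^sub>R J Z"
    have eq: "chern_coeff g' y Y Z = ?k y" if "y \<in> S" for y
      using conformal_domain.chern_coeff_conformal[OF conformal_domain_axioms that] .
    have D: "(?k has_derivative (\<lambda>X. frechet_derivative (\<lambda>y. chern_coeff g y Y Z) (at x) X
      + (1/2 * hess \<phi> x X Y) *\<^sub>R Z - (1/2 * hess \<phi> x X (J Y)) *\<^sub>R J Z)) (at x)"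
      unfolding hess_def
      by (intro has_derivative_diff has_derivative_add has_derivative_scaleR_left
          has_derivative_mult_right has_frechet_derivative dphi_differentiable G.chern_coeff_differentiable x)
    then have "?k differentiable (at x)" by (auto simp: differentiable_def)
    from frechet_derivative_cong_open[OF G.open_S x eq this] frechet_derivative_eqI[OF D] show ?thesis by simp
  qed
  show ?thesis
    unfolding chern_op_def d chern_coeff_conformal
    by (simp add: G.chern_coeff_simps[OF x] scaleR_add_right scaleR_diff_right scaleR_add_left scaleR_diff_left
      algebra_simps)
qed

end

context
  fixes x e assumes x: "x \<in> S" and e: "orthonormal_frame (g x) e"
begin

interpretation H: hermitian_form "g x" by (rule G.form[OF x])

lemma scaled_frame: "orthonormal_frame (g' x) (\<lambda>a. exp (- \<phi> x / 2) *\<^sub>R e a)"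
proof -
  have "exp (\<phi> x) * (exp (- \<phi> x / 2) * (exp (- \<phi> x / 2) * c)) = c" for c
    by (simp flip: exp_add mult.assoc)
  then show ?thesis
    using e by (simp add: orthonormal_frame_def conf[OF x] H.h_simps)
qed

lemma torsion_norm_sq_conformal:
  "exp (\<phi> x) * torsion_norm_sq g' x = torsion_norm_sq g x
     + 4 * (\<Sum>a\<in>UNIV. lee_form g x (e a) * d\<phi> x (e a))
     + 2 * (real CARD('n) - 1) * (\<Sum>a\<in>UNIV. (d\<phi> x (e a))\<^sup>2)"
proof -
  define s where "s = exp (- \<phi> x / 2)"
  have s: "s \<noteq> 0" "exp (\<phi> x) = 1 / (s * s)"
    by (simp_all add: s_def exp_minus field_simps flip: exp_add)
  let ?c = "\<lambda>a b. conformal_torsion (d\<phi> x) (e a) (e b)"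
  let ?T = "\<lambda>a b. chern_torsion g x (e a) (e b)"
  have "exp (\<phi> x) * torsion_norm_sq g' x =
      (\<Sum>a\<in>UNIV. \<Sum>b\<in>UNIV. g x (chern_torsion g' x (e a) (e b)) (chern_torsion g' x (e a) (e b)))"
    unfolding G'.torsion_norm_sq_eq[OF x scaled_frame[folded s_def]] sum_distrib_left
    using s(1) by (simp add: G'.chern_torsion_simps[OF x] conf[OF x] H.h_simps s(2))
  also have "\<dots> = (\<Sum>a\<in>UNIV. \<Sum>b\<in>UNIV. g x (?T a b) (?T a b) + 2 * g x (?T a b) (?c a b) + g x (?c a b) (?c a b))"
    by (simp add: chern_torsion_conformal[OF x] H.h_simps H.sym algebra_simps)
  also have "\<dots> = torsion_norm_sq g x + 2 * (\<Sum>a\<in>UNIV. \<Sum>b\<in>UNIV. g x (?T a b) (?c a b))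
      + (\<Sum>a\<in>UNIV. \<Sum>b\<in>UNIV. g x (?c a b) (?c a b))"
    by (simp only: sum.distrib G.torsion_norm_sq_eq[OF x e] flip: sum_distrib_left)
  finally show ?thesis
    using H.sum_inner_conformal_torsion[OF linear_dphi[OF x] e G.chern_torsion_bilinear[OF x]
        G.chern_torsion_skew[OF x] G.chern_torsion_J[OF x]]
    by (simp add: H.conformal_torsion_norm_sq[OF linear_dphi[OF x] e] mult.commute flip: G.lee_form_eq[OF x e])
qed

text \<open>
Insert \<open>\<theta>' = \<theta> + (n - 1) d\<phi>\<close> into \<open>codifferential_lee_form\<close> for \<open>g'\<close>, with the frame \<open>e\<^bsup>-\<phi>/2\<^esup> e\<close>.
\<close>

lemma codifferential_lee_form_conformal:
  "exp (\<phi> x) * codifferential g' (lee_form g') x = codifferential g (lee_form g) x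
     - (real CARD('n) - 1) * (\<Sum>a\<in>UNIV. hess \<phi> x (e a) (e a)
          + 2 * lee_form g x (e a) * d\<phi> x (e a) + (real CARD('n) - 1) * (d\<phi> x (e a))\<^sup>2)"
proof -
  define s where "s = exp (- \<phi> x / 2)"
  have s: "s \<noteq> 0" "exp (\<phi> x) = 1 / (s * s)"
    by (simp_all add: s_def exp_minus field_simps flip: exp_add)
  let ?m = "real CARD('n) - 1"
  let ?D = "\<lambda>a. frechet_derivative (\<lambda>y. lee_form g y (e a)) (at x) (e a)"
  have lin: "linear (\<lambda>v. frechet_derivative (\<lambda>y. lee_form g' y v) (at x) u)"
     "linear (\<lambda>u. frechet_derivative (\<lambda>y. lee_form g' y v) (at x) u)" for u v
    using linear_frechet_derivative_param[OF G.open_S x G'.lee_form_differentiable[OF x] G'.linear_lee_form]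
      linear_frechet_derivative[OF G'.lee_form_differentiable[OF x]] by auto
  have d: "frechet_derivative (\<lambda>y. lee_form g' y v) (at x) u =
      frechet_derivative (\<lambda>y. lee_form g y v) (at x) u + ?m * hess \<phi> x u v" for u v
  proof -
    have eq: "lee_form g' y v = lee_form g y v + ?m *\<^sub>R frechet_derivative \<phi> (at y) v" if "y \<in> S" for y
      by (simp add: lee_form_conformal[OF that])
    have "(\<lambda>y. ?m *\<^sub>R frechet_derivative \<phi> (at y) v) differentiable (at x)"
      by (intro differentiable_scaleR differentiable_const dphi_differentiable[OF x])
    note this' = G.lee_form_differentiable[OF x] this
    show ?thesis
      using frechet_derivative_cong_open[OF G.open_S x eq differentiable_add[OF this']]
        frechet_derivative_add[OF this'] frechet_derivative_scaleR[OF dphi_differentiable[OF x]]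
      by (simp add: hess_def)
  qed
  have "exp (\<phi> x) * codifferential g' (lee_form g') x =
      - (\<Sum>a\<in>UNIV. frechet_derivative (\<lambda>y. lee_form g' y (e a)) (at x) (e a) + (lee_form g' x (e a))\<^sup>2)"
    unfolding G'.codifferential_lee_form[OF x scaled_frame[folded s_def]] mult_minus_right sum_distrib_left
    using s(1) by (simp add: linear_scale[OF lin(1)] linear_scale[OF lin(2)]
        linear_scale[OF G'.linear_lee_form[OF x]] power2_eq_square s(2) distrib_left add_divide_distrib)
  also have "\<dots> = - (\<Sum>a\<in>UNIV. (?D a + (lee_form g x (e a))\<^sup>2) + ?m * (hess \<phi> x (e a) (e a)
          + 2 * lee_form g x (e a) * d\<phi> x (e a) + ?m * (d\<phi> x (e a))\<^sup>2))"
    by (simp add: d lee_form_conformal[OF x] power2_eq_square algebra_simps)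
  also have "\<dots> = codifferential g (lee_form g) x - ?m * (\<Sum>a\<in>UNIV. hess \<phi> x (e a) (e a)
          + 2 * lee_form g x (e a) * d\<phi> x (e a) + ?m * (d\<phi> x (e a))\<^sup>2)"
    unfolding G.codifferential_lee_form[OF x e] sum_distrib_left by (simp add: sum.distrib)
  finally show ?thesis .
qed

text \<open>
With \<open>Y = JX\<close> the first scalar in \<open>chern_op_conformal\<close> is multiplied by \<open>g(Z, JZ) = 0\<close>, the second is
\<open>\<partial>\<^sup>2\<phi>(X, X) + \<partial>\<^sup>2\<phi>(JX, JX)\<close> up to a factor, and the trace over \<open>Z\<close> contributes \<open>2n\<close>.
\<close>

lemma chern_scalar_curvature_conformal:
  "exp (\<phi> x) * chern_scalar_curvature g' x =
     chern_scalar_curvature g x - real CARD('n) * (\<Sum>a\<in>UNIV. hess \<phi> x (e a) (e a))"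
proof -
  define s where "s = exp (- \<phi> x / 2)"
  have s: "s \<noteq> 0" "exp (\<phi> x) = 1 / (s * s)"
    by (simp_all add: s_def exp_minus field_simps flip: exp_add)
  note lin = linear_scale[OF G'.chern_op_linear(1)[OF x]] linear_scale[OF G'.chern_op_linear(2)[OF x]]
    linear_scale[OF G'.chern_op_linear(3)[OF x]]
  have ee: "g x (e a) (e a) = 1" for a using e by (simp add: orthonormal_frame_def)
  have "exp (\<phi> x) * chern_scalar_curvature g' x =
      - 1/2 * (\<Sum>a\<in>UNIV. \<Sum>b\<in>UNIV. g x (chern_op g' x (e a) (J (e a)) (e b)) (J (e b)))"
    unfolding G'.chern_scalar_curvature_eq[OF x scaled_frame[folded s_def]]
      mult.left_commute[of "exp _"] sum_distrib_left[of "exp _"]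
    using s(1) by (simp add: lin conf[OF x] H.h_simps s(2))
  also have "\<dots> = - 1/2 * (\<Sum>a\<in>UNIV. \<Sum>b\<in>(UNIV::('n+'n) set). g x (chern_op g x (e a) (J (e a)) (e b)) (J (e b))
       + 1/2 * (hess \<phi> x (e a) (e a) + hess \<phi> x (J (e a)) (J (e a))))"
    by (simp add: chern_op_conformal[OF x] H.h_simps H.J_J_eq ee hess_simps[OF x] algebra_simps)
  also have "\<dots> = chern_scalar_curvature g x
       - 1/2 * real CARD('n) * ((\<Sum>a\<in>UNIV. hess \<phi> x (e a) (e a)) + (\<Sum>a\<in>UNIV. hess \<phi> x (J (e a)) (J (e a))))"
    unfolding G.chern_scalar_curvature_eq[OF x e]
    by (simp add: sum.distrib flip: sum_distrib_left sum_distrib_right sum_divide_distrib) (simp add: algebra_simps)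
  finally show ?thesis
    by (simp add: H.trace_J[OF hess_phi_bilinear[OF x] e])
qed

text \<open>
The coefficients of the Hessian are \<open>- n\<close> and \<open>- (t - n)\<close>, from the Chern scalar curvature and from the
codifferential. Those of \<open>\<theta>(e) d\<phi>(e)\<close> are \<open>- 2 (t - n)\<close> and \<open>t - 2n\<close>, from the codifferential and from
the torsion, and those of \<open>d\<phi>(e)\<^sup>2\<close> are \<open>n - 1\<close> times \<open>- (t - n)\<close> and \<open>(t - 2n)/2\<close>. They add up to \<open>- t\<close>, \<open>- t\<close> and \<open>- t (n - 1)/2\<close>.
\<close>

lemma deformed_scalar_curvature_conformal:
  assumes n: "CARD('n) \<ge> 2"
  shows "exp (\<phi> x) * local_deformed_scalar_curvature t g' x =
    local_deformed_scalar_curvature t g x - t * (\<Sum>a\<in>UNIV. hess \<phi> x (e a) (e a)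
      + lee_form g x (e a) * d\<phi> x (e a) + (real CARD('n) - 1) / 2 * (d\<phi> x (e a))\<^sup>2)"
proof -
  define m where "m = real CARD('n) - 1"
  have m: "m \<noteq> 0" "real CARD('n) = m + 1" using n by (auto simp: m_def)
  define A where "A = (\<Sum>a\<in>UNIV. hess \<phi> x (e a) (e a))"
  define B where "B = (\<Sum>a\<in>UNIV. lee_form g x (e a) * d\<phi> x (e a))"
  define C where "C = (\<Sum>a\<in>UNIV. (d\<phi> x (e a))\<^sup>2)"
  have 1: "exp (\<phi> x) * chern_scalar_curvature g' x = chern_scalar_curvature g x - (m + 1) * A"
    using chern_scalar_curvature_conformal by (simp add: A_def m(2))
  have 2: "exp (\<phi> x) * codifferential g' (lee_form g') x =
      codifferential g (lee_form g) x - m * (A + 2 * B + m * C)"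
    using codifferential_lee_form_conformal
    by (simp add: A_def B_def C_def m(2) sum.distrib sum_distrib_left mult.assoc)
  have 3: "exp (\<phi> x) * torsion_norm_sq g' x = torsion_norm_sq g x + 4 * B + 2 * m * C"
    using torsion_norm_sq_conformal by (simp add: B_def C_def m(2))
  have sum: "(\<Sum>a\<in>UNIV. hess \<phi> x (e a) (e a) + lee_form g x (e a) * d\<phi> x (e a) + m / 2 * (d\<phi> x (e a))\<^sup>2)
      = A + B + m / 2 * C"
    by (simp only: A_def B_def C_def sum.distrib sum_distrib_left)
  have "exp (\<phi> x) * local_deformed_scalar_curvature t g' x =
      exp (\<phi> x) * chern_scalar_curvature g' x
      + (t - (m + 1)) / m * (exp (\<phi> x) * codifferential g' (lee_form g') x)
      + (t - 2 * (m + 1)) / 4 * (exp (\<phi> x) * torsion_norm_sq g' x)"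
    by (simp add: local_deformed_scalar_curvature_def Let_def m(2) algebra_simps)
  also have "\<dots> = local_deformed_scalar_curvature t g x - t * (A + B + m / 2 * C)"
    unfolding 1 2 3 local_deformed_scalar_curvature_def Let_def m(2)
    using m(1) by (simp add: field_simps)
  finally show ?thesis by (simp only: sum flip: m_def)
qed

end

end

section \<open>The local strong maximum principle for the conformal factor\<close>

lemma linear_family_bounded:
  fixes l :: "'a::topological_space \<Rightarrow> 'b::euclidean_space \<Rightarrow> real"
  assumes B: "compact B" and c: "\<And>v. continuous_on B (\<lambda>x. l x v)" and l: "\<And>x. x \<in> B \<Longrightarrow> linear (l x)"
  obtains K where "K \<ge> 0" "\<And>x v. x \<in> B \<Longrightarrow> \<bar>l x v\<bar> \<le> K * norm v"
proof -
  have "continuous_on B (\<lambda>x. \<Sum>b\<in>Basis. \<bar>l x b\<bar>)"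
    by (intro continuous_intros c)
  then have "bounded ((\<lambda>x. \<Sum>b\<in>Basis. \<bar>l x b\<bar>) ` B)"
    using B compact_continuous_image compact_imp_bounded by blast
  then obtain K where K: "\<And>x. x \<in> B \<Longrightarrow> (\<Sum>b\<in>Basis. \<bar>l x b\<bar>) \<le> K"
    unfolding bounded_real by (metis abs_le_D1 imageI)
  show ?thesis
  proof
    show "0 \<le> max K 0" by simp
    fix x v assume x: "x \<in> B"
    have "l x v = l x (\<Sum>b\<in>Basis. (v \<bullet> b) *\<^sub>R b)" by (simp only: euclidean_representation)
    also have "\<dots> = (\<Sum>b\<in>Basis. (v \<bullet> b) * l x b)"
      by (simp add: linear_sum[OF l[OF x]] linear_scale[OF l[OF x]])
    finally have "\<bar>l x v\<bar> \<le> (\<Sum>b\<in>Basis. \<bar>(v \<bullet> b) * l x b\<bar>)" by simp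
    also have "\<dots> \<le> (\<Sum>b\<in>Basis. norm v * \<bar>l x b\<bar>)"
      by (intro sum_mono) (auto simp: abs_mult intro!: mult_right_mono Basis_le_norm)
    also have "\<dots> = norm v * (\<Sum>b\<in>Basis. \<bar>l x b\<bar>)" by (simp add: sum_distrib_left)
    also have "\<dots> \<le> norm v * max K 0" using K[OF x] by (intro mult_left_mono) auto
    finally show "\<bar>l x v\<bar> \<le> max K 0 * norm v" by (simp add: mult.commute)
  qed
qed

context hermitian_domain
begin

text \<open>
Extreme values of \<open>g(v, v)\<close> over the compact set of pairs \<open>(x, v)\<close> with \<open>|v| = 1\<close>. They provide the
uniform ellipticity bounds for frames that are chosen pointwise.
\<close>

lemma metric_comparable:
  assumes B: "compact B" "B \<noteq> {}" "B \<subseteq> S"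
  obtains c C where "0 < c" "0 < C" "\<And>x v. x \<in> B \<Longrightarrow> c * (v \<bullet> v) \<le> g x v v"
    "\<And>x v. x \<in> B \<Longrightarrow> g x v v \<le> C * (v \<bullet> v)"
proof -
  let ?D = "B \<times> sphere (0::'n cvec) 1"
  let ?G = "\<lambda>p. g (fst p) (snd p) (snd p)"
  have D: "compact ?D" "?D \<noteq> {}"
    using B by (auto intro!: compact_Times)
  have "continuous_on ?D (\<lambda>p. \<Sum>i\<in>Basis. \<Sum>j\<in>Basis. (snd p \<bullet> i) * (snd p \<bullet> j) * g (fst p) j i)"
  proof -
    have "continuous_on ?D (\<lambda>p. g (fst p) i j)" for i j
      using continuous_on_subset[OF smooth_on_continuous[OF smooth[of i j]] B(3)]
      by (intro continuous_on_compose2[of B "\<lambda>x. g x i j" _ fst]) (auto intro!: continuous_intros)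
    then show ?thesis by (intro continuous_intros)
  qed
  moreover have "?G p = (\<Sum>i\<in>Basis. \<Sum>j\<in>Basis. (snd p \<bullet> i) * (snd p \<bullet> j) * g (fst p) j i)" if "p \<in> ?D" for p
  proof -
    interpret H: hermitian_form "g (fst p)" using form B that by auto
    have "?G p = g (fst p) (\<Sum>i\<in>Basis. (snd p \<bullet> i) *\<^sub>R i) (\<Sum>j\<in>Basis. (snd p \<bullet> j) *\<^sub>R j)"
      by (simp only: euclidean_representation)
    then show ?thesis
      by (simp only: H.h_simps) (simp add: sum_distrib_left mult.assoc)
  qed
  ultimately have cont: "continuous_on ?D ?G" by simp
  obtain p where p: "p \<in> ?D" "\<And>q. q \<in> ?D \<Longrightarrow> ?G p \<le> ?G q"
    using continuous_attains_inf[OF D cont] by blast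
  obtain p' where p': "p' \<in> ?D" "\<And>q. q \<in> ?D \<Longrightarrow> ?G q \<le> ?G p'"
    using continuous_attains_sup[OF D cont] by blast
  have scale: "g x v v = (v \<bullet> v) * ?G (x, v /\<^sub>R norm v)" if "x \<in> B" "v \<noteq> 0" for x v
  proof -
    interpret H: hermitian_form "g x" using form B that by auto
    have "norm v * norm v * (inverse (norm v) * inverse (norm v)) = 1"
      using that(2) by (simp add: field_simps)
    then show ?thesis by (simp add: H.h_simps power2_eq_square flip: power2_norm_eq_inner)
  qed
  have in_D: "(x, v /\<^sub>R norm v) \<in> ?D" if "x \<in> B" "v \<noteq> 0" for x v
    using that by simp
  have z: "g x 0 0 = 0" if "x \<in> B" for x
    using linear_0[OF hermitian_form.lin_left[OF form]] B(3) that by blast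
  show ?thesis
  proof
    have "hermitian_form (g (fst p))" using form B p(1) by auto
    moreover have "snd p \<noteq> 0" using p(1) by auto
    ultimately show c: "0 < ?G p" using hermitian_form.pos by blast
    then show "0 < ?G p'" using p(2)[OF p'(1)] by simp
    fix x and v :: "'n cvec" assume x: "x \<in> B"
    show "?G p * (v \<bullet> v) \<le> g x v v"
    proof (cases "v = 0")
      case False
      have "(v \<bullet> v) * ?G p \<le> (v \<bullet> v) * ?G (x, v /\<^sub>R norm v)"
        by (intro mult_left_mono p(2) in_D x False) simp
      then show ?thesis using scale[OF x False] by (simp add: mult.commute)
    qed (simp add: z x)
    show "g x v v \<le> ?G p' * (v \<bullet> v)"
    proof (cases "v = 0")
      case False
      have "(v \<bullet> v) * ?G (x, v /\<^sub>R norm v) \<le> (v \<bullet> v) * ?G p'"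
        by (intro mult_left_mono p'(2) in_D x False) simp
      then show ?thesis using scale[OF x False] by (simp add: mult.commute)
    qed (simp add: z x)
  qed
qed

text \<open>
Expand \<open>\<xi>\<close> in the frame and apply the Cauchy-Schwarz inequality to \<open>\<xi> \<bullet> \<xi> = \<Sum>\<^sub>a g(\<xi>, e\<^sub>a) (\<xi> \<bullet> e\<^sub>a)\<close>.
\<close>

lemma frame_elliptic:
  assumes x: "x \<in> S" and e: "orthonormal_frame (g x) e"
    and C: "g x \<xi> \<xi> \<le> C * (\<xi> \<bullet> \<xi>)"
  shows "\<xi> \<bullet> \<xi> \<le> C * (\<Sum>a\<in>UNIV. (\<xi> \<bullet> e a)\<^sup>2)"
proof (cases "\<xi> = 0")
  case False
  interpret H: hermitian_form "g x" by (rule form[OF x])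
  have "\<xi> \<bullet> \<xi> = \<xi> \<bullet> (\<Sum>a\<in>UNIV. g x \<xi> (e a) *\<^sub>R e a)" by (simp only: H.orthonormal_expansion[OF e])
  then have "\<xi> \<bullet> \<xi> = (\<Sum>a\<in>UNIV. g x \<xi> (e a) * (\<xi> \<bullet> e a))" by (simp add: inner_sum_right)
  then have "(\<xi> \<bullet> \<xi>)\<^sup>2 \<le> (\<Sum>a\<in>UNIV. (g x \<xi> (e a))\<^sup>2) * (\<Sum>a\<in>UNIV. (\<xi> \<bullet> e a)\<^sup>2)"
    using Cauchy_Schwarz_ineq_sum by metis
  also have "(\<Sum>a\<in>UNIV. (g x \<xi> (e a))\<^sup>2) = g x \<xi> \<xi>"
    using H.parseval[OF e, of \<xi> \<xi>] by (simp add: power2_eq_square)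
  also have "g x \<xi> \<xi> * (\<Sum>a\<in>UNIV. (\<xi> \<bullet> e a)\<^sup>2) \<le> C * (\<xi> \<bullet> \<xi>) * (\<Sum>a\<in>UNIV. (\<xi> \<bullet> e a)\<^sup>2)"
    by (intro mult_right_mono C sum_nonneg) simp
  finally have "(\<xi> \<bullet> \<xi>) * (\<xi> \<bullet> \<xi>) \<le> (\<xi> \<bullet> \<xi>) * (C * (\<Sum>a\<in>UNIV. (\<xi> \<bullet> e a)\<^sup>2))"
    by (simp add: power2_eq_square mult_ac)
  then show ?thesis using False by (simp add: mult_le_cancel_left)
qed simp

text \<open>
The quadratic term is absorbed into the first order one: its coefficient \<open>m d\<phi>(e\<^sub>a)\<close>, like \<open>\<theta>(e\<^sub>a)\<close>, is
bounded near \<open>z\<close>.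
\<close>

lemma strong_maximum_principle_quadratic:
  fixes m :: real
  assumes phi: "smooth_on S \<phi>" and max: "\<And>x. x \<in> S \<Longrightarrow> \<phi> x \<le> M"
    and z: "z \<in> S" "\<phi> z = M"
    and pde: "\<And>x e. x \<in> S \<Longrightarrow> orthonormal_frame (g x) e \<Longrightarrow>
      (\<Sum>a\<in>UNIV. hess \<phi> x (e a) (e a) + lee_form g x (e a) * frechet_derivative \<phi> (at x) (e a)
        + m * (frechet_derivative \<phi> (at x) (e a))\<^sup>2) = 0"
  shows "\<exists>r>0. \<forall>x\<in>ball z r. x \<in> S \<and> \<phi> x = M"
proof -
  obtain r where r: "r > 0" "cball z r \<subseteq> S" using open_S z(1) open_contains_cball by blast
  have B: "compact (cball z r)" "cball z r \<noteq> {}" "cball z r \<subseteq> S" using r by auto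
  obtain c C where c: "0 < c" and C: "0 < C"
    and lo: "\<And>x v. x \<in> cball z r \<Longrightarrow> c * (v \<bullet> v) \<le> g x v v"
    and hi: "\<And>x v. x \<in> cball z r \<Longrightarrow> g x v v \<le> C * (v \<bullet> v)"
    using metric_comparable[OF B] by blast
  have clee: "continuous_on (cball z r) (\<lambda>x. lee_form g x v)" for v
    using lee_form_differentiable r(2)
    by (intro continuous_at_imp_continuous_on) (auto intro: differentiable_imp_continuous_within)
  have llee: "x \<in> cball z r \<Longrightarrow> linear (lee_form g x)" for x
    using linear_lee_form r(2) by blast
  obtain K1 where K1: "K1 \<ge> 0" "\<And>x v. x \<in> cball z r \<Longrightarrow> \<bar>lee_form g x v\<bar> \<le> K1 * norm v"
    using linear_family_bounded[OF B(1) clee llee] by blast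
  have cphi: "continuous_on (cball z r) (\<lambda>x. frechet_derivative \<phi> (at x) v)" for v
    using smooth_on_continuous[OF smooth_on_frechet_derivative[OF phi]] r(2) continuous_on_subset by blast
  have lphi: "x \<in> cball z r \<Longrightarrow> linear (frechet_derivative \<phi> (at x))" for x
    using linear_frechet_derivative[OF smooth_on_differentiable[OF phi]] r(2) by blast
  obtain K2 where K2: "K2 \<ge> 0" "\<And>x v. x \<in> cball z r \<Longrightarrow> \<bar>frechet_derivative \<phi> (at x) v\<bar> \<le> K2 * norm v"
    using linear_family_bounded[OF B(1) cphi lphi] by blast
  define \<Lambda> where "\<Lambda> = 1 / sqrt c"
  define K where "K = (K1 + \<bar>m\<bar> * K2) * \<Lambda>"
  let ?e = "\<lambda>a x. some_orthonormal_frame g x a"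
  have fr: "orthonormal_frame (g x) (\<lambda>a. ?e a x)" if "x \<in> S" for x
    using some_frame[OF that] by simp
  have bS: "x \<in> S" "x \<in> cball z r" if "x \<in> ball z r" for x using that r(2) by auto
  have up: "norm (?e a x) \<le> \<Lambda>" if x: "x \<in> ball z r" for a x
  proof -
    have "c * (?e a x \<bullet> ?e a x) \<le> 1"
      using lo[OF bS(2)[OF x], of "?e a x"] fr[OF bS(1)[OF x]] by (simp add: orthonormal_frame_def)
    then have "(norm (?e a x))\<^sup>2 \<le> 1 / c"
      using c by (simp add: power2_norm_eq_inner field_simps)
    then have "norm (?e a x) \<le> sqrt (1 / c)" by (rule real_le_rsqrt)
    then show ?thesis by (simp add: \<Lambda>_def real_sqrt_divide)
  qed
  have "\<exists>\<rho>>0. \<forall>x\<in>ball z \<rho>. x \<in> ball z r \<and> \<phi> x = M"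
  proof (rule strong_maximum_principle[where e = ?e and \<kappa> = "1 / C" and \<Lambda> = \<Lambda> and K = K])
    show "smooth_on (ball z r) \<phi>" using smooth_on_subset[OF phi] bS by blast
    show "\<phi> x \<le> M" if "x \<in> ball z r" for x using max bS that by blast
    show "1 / C * (\<xi> \<bullet> \<xi>) \<le> (\<Sum>a\<in>UNIV. (\<xi> \<bullet> ?e a x)\<^sup>2)" if x: "x \<in> ball z r" for x \<xi>
      using frame_elliptic[OF bS(1)[OF x] fr[OF bS(1)[OF x]] hi[OF bS(2)[OF x]], of \<xi>] C
      by (simp add: field_simps)
    show "- K * (\<Sum>a\<in>UNIV. \<bar>frechet_derivative \<phi> (at x) (?e a x)\<bar>)
        \<le> (\<Sum>a\<in>UNIV. hess \<phi> x (?e a x) (?e a x))" if x: "x \<in> ball z r" for x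
    proof -
      let ?d = "\<lambda>a. frechet_derivative \<phi> (at x) (?e a x)"
      let ?b = "\<lambda>a. lee_form g x (?e a x) + m * ?d a"
      have "\<bar>?b a\<bar> \<le> K" for a
      proof -
        have "\<bar>?b a\<bar> \<le> \<bar>lee_form g x (?e a x)\<bar> + \<bar>m\<bar> * \<bar>?d a\<bar>"
          using abs_triangle_ineq[of "lee_form g x (?e a x)" "m * ?d a"] by (simp only: abs_mult)
        also have "\<dots> \<le> K1 * norm (?e a x) + \<bar>m\<bar> * (K2 * norm (?e a x))"
          by (intro add_mono mult_left_mono K1 K2 bS(2)[OF x]) simp
        also have "\<dots> = (K1 + \<bar>m\<bar> * K2) * norm (?e a x)" by (simp add: algebra_simps)
        also have "\<dots> \<le> K" unfolding K_def using K1(1) K2(1) by (intro mult_left_mono up x) simp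
        finally show ?thesis .
      qed
      then have "\<bar>?b a\<bar> * \<bar>?d a\<bar> \<le> K * \<bar>?d a\<bar>" for a
        by (intro mult_right_mono) auto
      moreover have "?b a * ?d a \<le> \<bar>?b a\<bar> * \<bar>?d a\<bar>" for a
        using abs_ge_self[of "?b a * ?d a"] by (simp only: abs_mult)
      ultimately have "?b a * ?d a \<le> K * \<bar>?d a\<bar>" for a
        by (rule order_trans[rotated])
      then have "(\<Sum>a\<in>UNIV. ?b a * ?d a) \<le> (\<Sum>a\<in>UNIV. K * \<bar>?d a\<bar>)" by (intro sum_mono)
      moreover have "(\<Sum>a\<in>UNIV. hess \<phi> x (?e a x) (?e a x) + ?b a * ?d a) = 0"
        using pde[OF bS(1)[OF x] fr[OF bS(1)[OF x]]]
        by (simp add: power2_eq_square distrib_right mult.assoc add.assoc)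
      ultimately show ?thesis by (simp add: sum_distrib_left sum.distrib sum_negf)
    qed
  qed (use z r C up in auto)
  then show ?thesis using bS by blast
qed

end

section \<open>Charts and the global argument\<close>

lemma chart_inv_chart_map:
  assumes "complex_atlas A" "c \<in> A" "p \<in> chart_dom c"
  shows "chart_inv c (chart_map c p) = p"
  using assms unfolding complex_atlas_def homeomorphism_def by blast

text \<open>
Proportional fundamental forms mean proportional metrics, since \<open>J\<close> is invertible.
\<close>

lemma conformal_domain_chart:
  fixes A :: "('m::t2_space, 'n::finite) chart set"
  assumes atlas: "complex_atlas A" and g: "hermitian_metric A g" and g': "hermitian_metric A g'"
    and f: "smooth_function A f" and resc: "rescaled A (\<lambda>p. exp (f p)) g g'" and c: "c \<in> A"
  shows "conformal_domain (chart_im c) (g c) (g' c) (f \<circ> chart_inv c)"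
proof -
  have dom: "hermitian_domain (chart_im c) (k c)" if "hermitian_metric A k" for k
    using that atlas c
    unfolding hermitian_metric_def complex_atlas_def hermitian_domain_def hermitian_form_def by blast
  have "g' c x u v = exp ((f \<circ> chart_inv c) x) * g c x u v" if x: "x \<in> chart_im c" for x u v
  proof -
    obtain p where p: "p \<in> chart_dom c" "x = chart_map c p" using x by (auto simp: chart_im_def)
    \<comment> \<open>\<open>J (- J u) = u\<close>\<close>
    have "fundamental_form (g' c) x (- J u) v = exp (f p) * fundamental_form (g c) x (- J u) v"
      using resc c p unfolding rescaled_def by blast
    then show ?thesis
      using chart_inv_chart_map[OF atlas c p(1)] p(2) by (simp add: fundamental_form_def)
  qed
  moreover have "smooth_on (chart_im c) (f \<circ> chart_inv c)" using f c by (simp add: smooth_function_def)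
  ultimately show ?thesis
    using dom[OF g] dom[OF g'] by (simp add: conformal_domain_def conformal_domain_axioms_def)
qed

lemma smooth_function_continuous:
  assumes atlas: "complex_atlas A" and f: "smooth_function A f"
  shows "continuous_on UNIV f"
proof -
  have "continuous_on (chart_dom c) f" if c: "c \<in> A" for c
  proof -
    have "continuous_on (chart_dom c) (chart_map c)"
      using atlas c by (auto simp: complex_atlas_def homeomorphism_def)
    moreover have "smooth_on (chart_im c) (f \<circ> chart_inv c)" using f c by (simp add: smooth_function_def)
    from smooth_on_continuous[OF this]
    have "continuous_on (chart_map c ` chart_dom c) (f \<circ> chart_inv c)" by (simp only: chart_im_def)
    ultimately have "continuous_on (chart_dom c) ((f \<circ> chart_inv c) \<circ> chart_map c)"
      by (rule continuous_on_compose)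
    then show ?thesis
      using chart_inv_chart_map[OF atlas c] by (simp cong: continuous_on_cong)
  qed
  then have "continuous_on (\<Union>c\<in>A. chart_dom c) f"
    using atlas by (intro continuous_on_open_UN) (auto simp: complex_atlas_def)
  then show ?thesis using atlas by (simp add: complex_atlas_def)
qed

theorem proposition3p7:
  fixes A :: "('m::t2_space, 'n::finite) chart set"
    and g g' :: "('m, 'n) mfd_metric"
    and t \<mu> \<mu>' :: real
  assumes "CARD('n) \<ge> 2"
    and "compact (UNIV :: 'm set)"
    and "connected (UNIV :: 'm set)"
    and "complex_atlas A"
    and "t > 0"
    and "hermitian_metric A g"
    and "hermitian_metric A g'"
    and "is_deformed_scalar_curvature A t g (\<lambda>_. \<mu>)"
    and "is_deformed_scalar_curvature A t g' (\<lambda>_. \<mu>')"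
    and "conformal A g g'"
  shows "((\<mu> = 0 \<and> \<mu>' = 0) \<or> (\<mu> \<noteq> 0 \<and> \<mu>' \<noteq> 0 \<and> sgn \<mu> = sgn \<mu>'))
       \<and> (\<mu> \<le> 0 \<longrightarrow> (\<exists>a>0. rescaled A (\<lambda>_. a) g g'))"
proof -
  note atlas = \<open>complex_atlas A\<close>
  obtain f where f: "smooth_function A f" and resc: "rescaled A (\<lambda>p. exp (f p)) g g'"
    using \<open>conformal A g g'\<close> by (auto simp: conformal_def)
  have dom: "conformal_domain (chart_im c) (g c) (g' c) (f \<circ> chart_inv c)" if "c \<in> A" for c
    by (rule conformal_domain_chart[OF atlas assms(6,7) f resc that])
  have cont: "continuous_on UNIV f" by (rule smooth_function_continuous[OF atlas f])
  let ?L = "\<lambda>c x e a. hess (f \<circ> chart_inv c) x (e a) (e a)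
      + lee_form (g c) x (e a) * frechet_derivative (f \<circ> chart_inv c) (at x) (e a)
      + (real CARD('n) - 1) / 2 * (frechet_derivative (f \<circ> chart_inv c) (at x) (e a))\<^sup>2"
  have pde: "exp ((f \<circ> chart_inv c) x) * \<mu>' = \<mu> - t * (\<Sum>a\<in>UNIV. ?L c x e a)"
    if c: "c \<in> A" and x: "x \<in> chart_im c" and e: "orthonormal_frame (g c x) e" for c x e
  proof -
    obtain p where p: "p \<in> chart_dom c" "x = chart_map c p" using x by (auto simp: chart_im_def)
    have "\<mu> = local_deformed_scalar_curvature t (g c) x" "\<mu>' = local_deformed_scalar_curvature t (g' c) x"
      using assms(8,9) c p by (auto simp: is_deformed_scalar_curvature_def)
    then show ?thesis
      using conformal_domain.deformed_scalar_curvature_conformal[OF dom[OF c] x e assms(1), of t] by simp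
  qed
  have chart: "\<exists>c\<in>A. p \<in> chart_dom c" for p
    using atlas by (auto simp: complex_atlas_def)
  have at: "chart_map c p \<in> chart_im c" "(f \<circ> chart_inv c) (chart_map c p) = f p"
    if "c \<in> A" "p \<in> chart_dom c" for c p
    using that chart_inv_chart_map[OF atlas that] by (auto simp: chart_im_def)
  obtain pM where pM: "\<And>p. f p \<le> f pM"
    using continuous_attains_sup[OF assms(2) _ cont] by auto
  obtain pm where pm: "\<And>p. f pm \<le> f p"
    using continuous_attains_inf[OF assms(2) _ cont] by auto
  have upper: "\<mu> \<le> exp (f pM) * \<mu>'"
  proof -
    obtain c where c: "c \<in> A" "pM \<in> chart_dom c" using chart by blast
    interpret D: conformal_domain "chart_im c" "g c" "g' c" "f \<circ> chart_inv c" by (rule dom[OF c(1)])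
    obtain e where e: "orthonormal_frame (g c (chart_map c pM)) e"
      using hermitian_form.orthonormal_frame_exists[OF D.G.form[OF at(1)[OF c]]] by blast
    note m = smooth_max_test[OF D.G.open_S at(1)[OF c] D.phi]
    have max: "(f \<circ> chart_inv c) y \<le> (f \<circ> chart_inv c) (chart_map c pM)" for y
      using at(2)[OF c] pM by simp
    have "(\<Sum>a\<in>UNIV. ?L c (chart_map c pM) e a) \<le> 0"
      using m[OF max] by (intro sum_nonpos) simp
    then have "0 \<le> - t * (\<Sum>a\<in>UNIV. ?L c (chart_map c pM) e a)"
      using assms(5) by (simp add: mult_nonneg_nonpos)
    then show ?thesis using pde[OF c(1) at(1)[OF c] e] at(2)[OF c] by simp
  qed
  have lower: "exp (f pm) * \<mu>' \<le> \<mu>"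
  proof -
    obtain c where c: "c \<in> A" "pm \<in> chart_dom c" using chart by blast
    interpret D: conformal_domain "chart_im c" "g c" "g' c" "f \<circ> chart_inv c" by (rule dom[OF c(1)])
    obtain e where e: "orthonormal_frame (g c (chart_map c pm)) e"
      using hermitian_form.orthonormal_frame_exists[OF D.G.form[OF at(1)[OF c]]] by blast
    note m = smooth_min_test[OF D.G.open_S at(1)[OF c] D.phi]
    have min: "(f \<circ> chart_inv c) (chart_map c pm) \<le> (f \<circ> chart_inv c) y" for y
      using at(2)[OF c] pm by simp
    have "0 \<le> (\<Sum>a\<in>UNIV. ?L c (chart_map c pm) e a)"
      using m[OF min] by (intro sum_nonneg) simp
    then have "0 \<le> t * (\<Sum>a\<in>UNIV. ?L c (chart_map c pm) e a)"
      using assms(5) by simp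
    then show ?thesis using pde[OF c(1) at(1)[OF c] e] at(2)[OF c] by simp
  qed
  have sign: "(\<mu> = 0 \<and> \<mu>' = 0) \<or> (\<mu> > 0 \<and> \<mu>' > 0) \<or> (\<mu> < 0 \<and> \<mu>' < 0)"
    using upper lower exp_gt_zero[of "f pM"] exp_gt_zero[of "f pm"]
    by (smt (verit) mult_neg_pos mult_pos_neg mult_pos_pos zero_less_mult_iff mult_eq_0_iff)
  have const: "f p = f pM" if neg: "\<mu> \<le> 0" for p
  proof (cases "\<mu> < 0")
    case True
    then have "\<mu>' < 0" using sign by auto
    moreover have "exp (f pm) * \<mu>' \<le> exp (f pM) * \<mu>'" using upper lower by simp
    ultimately have "f pM \<le> f pm" by simp
    then show ?thesis using pM[of p] pm[of p] by simp
  next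
    case False
    then have zero: "\<mu> = 0" "\<mu>' = 0" using neg sign by auto
    define Z where "Z = {p. f p = f pM}"
    have "closed Z" unfolding Z_def
      using continuous_closed_preimage_constant[OF cont closed_UNIV, of "f pM"] by simp
    moreover have "open Z"
    proof (subst open_subopen, intro ballI)
      fix p assume p: "p \<in> Z"
      obtain c where c: "c \<in> A" "p \<in> chart_dom c" using chart by blast
      interpret D: conformal_domain "chart_im c" "g c" "g' c" "f \<circ> chart_inv c" by (rule dom[OF c(1)])
      have "\<exists>r>0. \<forall>x\<in>ball (chart_map c p) r. x \<in> chart_im c \<and> (f \<circ> chart_inv c) x = f pM"
      proof (rule D.G.strong_maximum_principle_quadratic[OF D.phi])
        show "(\<Sum>a\<in>UNIV. ?L c x e a) = 0"
          if "x \<in> chart_im c" "orthonormal_frame (g c x) e" for x e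
          using pde[OF c(1) that] zero assms(5) by simp
      qed (use at[OF c] pM p in \<open>auto simp: Z_def\<close>)
      then obtain r where r: "r > 0" "\<And>x. x \<in> ball (chart_map c p) r \<Longrightarrow> (f \<circ> chart_inv c) x = f pM"
        by blast
      let ?T = "chart_dom c \<inter> chart_map c -` ball (chart_map c p) r"
      have "open ?T"
        using atlas c(1) by (intro continuous_open_preimage) (auto simp: complex_atlas_def homeomorphism_def)
      moreover have "p \<in> ?T" using c r(1) by simp
      moreover have "f q = f pM" if "q \<in> ?T" for q
        using r(2)[of "chart_map c q"] at(2)[OF c(1), of q] that by simp
      then have "?T \<subseteq> Z" by (auto simp: Z_def)
      ultimately show "\<exists>T. open T \<and> p \<in> T \<and> T \<subseteq> Z" by blast
    qed
    ultimately have "Z = {} \<or> Z = UNIV"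
      using assms(3) by (simp add: connected_clopen)
    then show ?thesis by (auto simp: Z_def)
  qed
  have "\<exists>a>0. rescaled A (\<lambda>_. a) g g'" if "\<mu> \<le> 0"
  proof -
    have "(\<lambda>p. exp (f p)) = (\<lambda>_. exp (f pM))"
      by (intro ext arg_cong[where f = exp] const that)
    then show ?thesis using resc by (intro exI[of _ "exp (f pM)"]) simp
  qed
  then show ?thesis using sign by auto
qed

end
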